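(* Let $d\geq 1$, let $G$ be a graph and let $G^v$ be its cone graph. Then $G^v$ is $M$-connected in $\mathbb{R}^{d+1}$ if and only if $G$ is connected and has no $M$-bridges in $\mathbb{R}^d$.
   Context: The cone $G^v$ of $G=(V,E)$ is obtained by adding a new vertex $v$ and all edges $uv$, $u\in V$. For $p:V\to\mathbb{R}^k$ the rigidity matrix has, for each edge $uw$, a row with $p(u)-p(w)$ in the columns of $u$, $p(w)-p(u)$ in those of $w$, zeros elsewhere; the rigidity matroid $\mathcal{R}_k(G)$ on $E$ is given by row independence for generic $p$ (coordinates algebraically independent over $\mathbb{Q}$), with rank function $r_k$. $G$ is $M$-connected in $\mathbb{R}^k$ if $\mathcal{R}_k(G)$ is connected (any two distinct edges lie in a common circuit). An edge $e$ is an $M$-bridge in $\mathbb{R}^k$ if $r_k(G-e)=r_k(G)-1$. *)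

theory Defs
  imports Complex_Main
begin

text \<open>Finite simple graphs: a finite vertex set V and an edge set E of 2-element subsets of V.\<close>
definition simple_graph :: "'a set \<Rightarrow> 'a set set \<Rightarrow> bool" where
  "simple_graph V E \<longleftrightarrow> finite V \<and> (\<forall>e\<in>E. \<exists>a b. a \<in> V \<and> b \<in> V \<and> a \<noteq> b \<and> e = {a, b})"

definition graph_connected :: "'a set \<Rightarrow> 'a set set \<Rightarrow> bool" where
  "graph_connected V E \<longleftrightarrow> (\<forall>u\<in>V. \<forall>w\<in>V. (u, w) \<in> {(a, b). {a, b} \<in> E}\<^sup>*)"

text \<open>The cone G^v: add vertex v and all edges uv, u in V.\<close>
definition cone_vertices :: "'a set \<Rightarrow> 'a \<Rightarrow> 'a set" where
  "cone_vertices V v = insert v V"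

definition cone_edges :: "'a set \<Rightarrow> 'a set set \<Rightarrow> 'a \<Rightarrow> 'a set set" where
  "cone_edges V E v = E \<union> {{u, v} | u. u \<in> V}"

text \<open>Algebraic independence over Q of the reals x i, i in the finite set I:
  no nonzero polynomial with rational coefficients in the variables indexed by I vanishes at x.
  A polynomial is given by a finitely supported coefficient function on exponent vectors.\<close>
definition alg_indep_Q :: "('i \<Rightarrow> real) \<Rightarrow> 'i set \<Rightarrow> bool" where
  "alg_indep_Q x I \<longleftrightarrow>
     (\<forall>c :: ('i \<Rightarrow> nat) \<Rightarrow> real.
        finite {m. c m \<noteq> 0} \<and> (\<forall>m. c m \<in> \<rat>) \<and>
        (\<forall>m. c m \<noteq> 0 \<longrightarrow> (\<forall>i. i \<notin> I \<longrightarrow> m i = 0)) \<and>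
        (\<Sum>m\<in>{m. c m \<noteq> 0}. c m * (\<Prod>i\<in>I. x i ^ m i)) = 0
        \<longrightarrow> (\<forall>m. c m = 0))"

text \<open>A configuration p : V \<rightarrow> R^k (coordinates p u i, i < k) is generic if its
  coordinates are algebraically independent over Q.\<close>
definition generic_config :: "nat \<Rightarrow> 'a set \<Rightarrow> ('a \<Rightarrow> nat \<Rightarrow> real) \<Rightarrow> bool" where
  "generic_config k V p \<longleftrightarrow> alg_indep_Q (\<lambda>(u, i). p u i) (V \<times> {..<k})"

text \<open>Row of the rigidity matrix for edge e = uw: entry in column (x, i) is
  p(x)_i - p(y)_i if x is an endpoint of e and y the other endpoint, 0 otherwise.\<close>
definition rig_row :: "('a \<Rightarrow> nat \<Rightarrow> real) \<Rightarrow> 'a set \<Rightarrow> 'a \<Rightarrow> nat \<Rightarrow> real" where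
  "rig_row p e x i = (if x \<in> e then p x i - p (THE y. y \<in> e \<and> y \<noteq> x) i else 0)"

text \<open>Rows indexed by F are linearly independent (columns: V \<times> {0..<k}).\<close>
definition rows_indep :: "nat \<Rightarrow> 'a set \<Rightarrow> ('a \<Rightarrow> nat \<Rightarrow> real) \<Rightarrow> 'a set set \<Rightarrow> bool" where
  "rows_indep k V p F \<longleftrightarrow>
     (\<forall>a :: 'a set \<Rightarrow> real.
        (\<forall>x\<in>V. \<forall>i<k. (\<Sum>e\<in>F. a e * rig_row p e x i) = 0) \<longrightarrow> (\<forall>e\<in>F. a e = 0))"

text \<open>Independence in the rigidity matroid R_k(G): rows independent for generic p.\<close>
definition rig_indep :: "nat \<Rightarrow> 'a set \<Rightarrow> 'a set set \<Rightarrow> bool" where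
  "rig_indep k V F \<longleftrightarrow> finite F \<and> (\<exists>p. generic_config k V p \<and> rows_indep k V p F)"

definition rig_rank :: "nat \<Rightarrow> 'a set \<Rightarrow> 'a set set \<Rightarrow> nat" where
  "rig_rank k V F = Max {card I | I. I \<subseteq> F \<and> rig_indep k V I}"

definition rig_circuit :: "nat \<Rightarrow> 'a set \<Rightarrow> 'a set set \<Rightarrow> 'a set set \<Rightarrow> bool" where
  "rig_circuit k V E C \<longleftrightarrow> C \<subseteq> E \<and> \<not> rig_indep k V C \<and> (\<forall>D. D \<subset> C \<longrightarrow> rig_indep k V D)"

text \<open>M-connected: any two distinct edges lie in a common circuit.\<close>
definition M_connected :: "nat \<Rightarrow> 'a set \<Rightarrow> 'a set set \<Rightarrow> bool" where
  "M_connected k V E \<longleftrightarrow>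
     (\<forall>e\<in>E. \<forall>f\<in>E. e \<noteq> f \<longrightarrow> (\<exists>C. rig_circuit k V E C \<and> e \<in> C \<and> f \<in> C))"

definition M_bridge :: "nat \<Rightarrow> 'a set \<Rightarrow> 'a set set \<Rightarrow> 'a set \<Rightarrow> bool" where
  "M_bridge k V E e \<longleftrightarrow> e \<in> E \<and> rig_rank k V (E - {e}) = rig_rank k V E - 1"

end

theory Submission
  imports Defs "Jordan_Normal_Form.Determinant" "HOL-Analysis.Continuum_Not_Denumerable"
begin

text \<open>
  Independence of rows at a single configuration is witnessed by a nonzero Gram determinant, a
  rational polynomial in the coordinates, so it persists at every generic configuration; hence
  the rigidity matroid is the linear matroid of the rows at any one generic configuration.

  Coning: projecting the cone centrally from its apex v matches stresses of F in dimension d with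
  stresses of F plus spokes in dimension d + 1, the coefficients on the spokes being forced. So a
  set of edges F is independent in dimension d iff the cone over F is independent in dimension
  d + 1, and bridges of G remain bridges in the cone. If G is disconnected, its cone is glued from
  two pieces at the vertex v and its matroid is a direct sum. Conversely, the cone over a circuit
  C, with spokes to the vertices of C only, is a circuit; if G has no bridges then each edge uw
  thus shares a circuit with the spokes uv and wv, and connectivity of G together with
  transitivity of the relation "lie in a common circuit" joins all edges of the cone.
\<close>

section \<open>Rational polynomials and algebraically independent points\<close>

text \<open>The inductive form lets membership of Gram determinants follow from closure rules alone;
  the coefficient functions quantified over in \<open>alg_indep_Q\<close> are recovered in
  \<open>ratpoly_coefficients\<close>.\<close>

inductive_set ratpoly :: "'i set \<Rightarrow> (('i \<Rightarrow> real) \<Rightarrow> real) set" for I where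
  const: "q \<in> \<rat> \<Longrightarrow> (\<lambda>x. q) \<in> ratpoly I"
| var: "i \<in> I \<Longrightarrow> (\<lambda>x. x i) \<in> ratpoly I"
| add: "f \<in> ratpoly I \<Longrightarrow> g \<in> ratpoly I \<Longrightarrow> (\<lambda>x. f x + g x) \<in> ratpoly I"
| mult: "f \<in> ratpoly I \<Longrightarrow> g \<in> ratpoly I \<Longrightarrow> (\<lambda>x. f x * g x) \<in> ratpoly I"

lemma ratpoly_diff:
  assumes "f \<in> ratpoly I" "g \<in> ratpoly I"
  shows "(\<lambda>x. f x - g x) \<in> ratpoly I"
proof -
  have "(\<lambda>x. f x + (-1) * g x) \<in> ratpoly I"
    by (intro ratpoly.add ratpoly.mult ratpoly.const assms) auto
  then show ?thesis by simp
qed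

lemma ratpoly_sum:
  assumes "\<And>j. j \<in> J \<Longrightarrow> f j \<in> ratpoly I"
  shows "(\<lambda>x. \<Sum>j\<in>J. f j x) \<in> ratpoly I"
  using assms
  by (induction J rule: infinite_finite_induct)
     (auto intro: ratpoly.const ratpoly.add)

lemma ratpoly_prod:
  assumes "\<And>j. j \<in> J \<Longrightarrow> f j \<in> ratpoly I"
  shows "(\<lambda>x. \<Prod>j\<in>J. f j x) \<in> ratpoly I"
  using assms
  by (induction J rule: infinite_finite_induct)
     (auto intro: ratpoly.const ratpoly.mult)

lemma ratpoly_coefficients:
  assumes "finite I" "f \<in> ratpoly I"
  shows "\<exists>c. finite {m. c m \<noteq> 0} \<and> (\<forall>m. c m \<in> \<rat>) \<and>
           (\<forall>m. c m \<noteq> 0 \<longrightarrow> (\<forall>i. i \<notin> I \<longrightarrow> m i = 0)) \<and>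
           (\<forall>x. f x = (\<Sum>m\<in>{m. c m \<noteq> 0}. c m * (\<Prod>i\<in>I. x i ^ m i)))"
  using assms(2)
proof induction
  case (const q)
  define c where "c = (\<lambda>m::'a \<Rightarrow> nat. if m = (\<lambda>_. 0) then q else 0)"
  have "{m. c m \<noteq> 0} = (if q = 0 then {} else {\<lambda>_. 0})" by (auto simp: c_def)
  then show ?case using const by (intro exI[of _ c]) (auto simp: c_def)
next
  case (var j)
  define d where "d = (\<lambda>i. if i = j then 1 else 0 :: nat)"
  define c where "c = (\<lambda>m. if m = d then 1 else 0 :: real)"
  have "{m. c m \<noteq> 0} = {d}" by (auto simp: c_def)
  moreover have "x j = (\<Prod>i\<in>I. x i ^ d i)" for x :: "'a \<Rightarrow> real"
  proof -
    have "(\<Prod>i\<in>I. x i ^ d i) = (\<Prod>i\<in>I. if i = j then x j else 1)"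
      by (rule prod.cong) (auto simp: d_def)
    then show ?thesis using var assms(1) by simp
  qed
  ultimately show ?case using var
    by (intro exI[of _ c]) (auto simp: c_def d_def split: if_splits)
next
  case (add f g)
  then obtain c1 c2 where
    c1: "finite {m. c1 m \<noteq> 0}" "\<forall>m. c1 m \<in> \<rat>"
      "\<forall>m. c1 m \<noteq> 0 \<longrightarrow> (\<forall>i. i \<notin> I \<longrightarrow> m i = 0)"
      "\<forall>x. f x = (\<Sum>m\<in>{m. c1 m \<noteq> 0}. c1 m * (\<Prod>i\<in>I. x i ^ m i))" and
    c2: "finite {m. c2 m \<noteq> 0}" "\<forall>m. c2 m \<in> \<rat>"
      "\<forall>m. c2 m \<noteq> 0 \<longrightarrow> (\<forall>i. i \<notin> I \<longrightarrow> m i = 0)"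
      "\<forall>x. g x = (\<Sum>m\<in>{m. c2 m \<noteq> 0}. c2 m * (\<Prod>i\<in>I. x i ^ m i))"
    by blast
  define c where "c = (\<lambda>m. c1 m + c2 m)"
  let ?U = "{m. c1 m \<noteq> 0} \<union> {m. c2 m \<noteq> 0}"
  have fin: "finite ?U" using c1 c2 by simp
  have sub: "{m. c m \<noteq> 0} \<subseteq> ?U" by (auto simp: c_def)
  have ext: "(\<Sum>m\<in>{m. b m \<noteq> 0}. b m * (\<Prod>i\<in>I. x i ^ m i)) = (\<Sum>m\<in>?U. b m * (\<Prod>i\<in>I. x i ^ m i))"
    if "{m. b m \<noteq> 0} \<subseteq> ?U" for b and x :: "'a \<Rightarrow> real"
    using that fin by (intro sum.mono_neutral_left) auto
  have "f x + g x = (\<Sum>m\<in>{m. c m \<noteq> 0}. c m * (\<Prod>i\<in>I. x i ^ m i))" for x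
    unfolding c1(4)[rule_format] c2(4)[rule_format]
    by (subst (1 2 3) ext) (auto simp: c_def sum.distrib algebra_simps)
  moreover have "finite {m. c m \<noteq> 0}" using sub fin by (rule finite_subset)
  ultimately show ?case using c1 c2 sub
    by (intro exI[of _ c]) (auto simp: c_def)
next
  case (mult f g)
  then obtain c1 c2 where
    c1: "finite {m. c1 m \<noteq> 0}" "\<forall>m. c1 m \<in> \<rat>"
      "\<forall>m. c1 m \<noteq> 0 \<longrightarrow> (\<forall>i. i \<notin> I \<longrightarrow> m i = 0)"
      "\<forall>x. f x = (\<Sum>m\<in>{m. c1 m \<noteq> 0}. c1 m * (\<Prod>i\<in>I. x i ^ m i))" and
    c2: "finite {m. c2 m \<noteq> 0}" "\<forall>m. c2 m \<in> \<rat>"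
      "\<forall>m. c2 m \<noteq> 0 \<longrightarrow> (\<forall>i. i \<notin> I \<longrightarrow> m i = 0)"
      "\<forall>x. g x = (\<Sum>m\<in>{m. c2 m \<noteq> 0}. c2 m * (\<Prod>i\<in>I. x i ^ m i))"
    by blast
  let ?S = "{m. c1 m \<noteq> 0} \<times> {m. c2 m \<noteq> 0}"
  \<comment> \<open>\<open>h\<close> adds exponent vectors, so \<open>c\<close> is the convolution
    of \<open>c1\<close> and \<open>c2\<close>.\<close>
  define h :: "('a \<Rightarrow> nat) \<times> ('a \<Rightarrow> nat) \<Rightarrow> 'a \<Rightarrow> nat" where "h = (\<lambda>(m, n) i. m i + n i)"
  define c where "c = (\<lambda>m. \<Sum>s\<in>{s\<in>?S. h s = m}. c1 (fst s) * c2 (snd s))"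
  have fin: "finite ?S" using c1 c2 by simp
  have sub: "{m. c m \<noteq> 0} \<subseteq> h ` ?S"
  proof
    fix m assume "m \<in> {m. c m \<noteq> 0}"
    then have "{s\<in>?S. h s = m} \<noteq> {}" unfolding c_def by (intro notI) (simp only: sum.empty mem_Collect_eq)
    then show "m \<in> h ` ?S" by blast
  qed
  have eq: "f x * g x = (\<Sum>m\<in>{m. c m \<noteq> 0}. c m * (\<Prod>i\<in>I. x i ^ m i))" for x
  proof -
    have "f x * g x = (\<Sum>s\<in>?S. c1 (fst s) * c2 (snd s) * (\<Prod>i\<in>I. x i ^ h s i))"
      unfolding c1(4)[rule_format] c2(4)[rule_format] sum_product sum.cartesian_product
      by (rule sum.cong) (auto simp: h_def power_add prod.distrib)
    also have "\<dots> = (\<Sum>m\<in>h ` ?S. \<Sum>s\<in>{s\<in>?S. h s = m}. c1 (fst s) * c2 (snd s) * (\<Prod>i\<in>I. x i ^ h s i))"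
      by (rule sum.image_gen[OF fin])
    also have "\<dots> = (\<Sum>m\<in>h ` ?S. c m * (\<Prod>i\<in>I. x i ^ m i))"
      unfolding c_def sum_distrib_right by (intro sum.cong) auto
    also have "\<dots> = (\<Sum>m\<in>{m. c m \<noteq> 0}. c m * (\<Prod>i\<in>I. x i ^ m i))"
      using sub fin by (intro sum.mono_neutral_right) auto
    finally show ?thesis .
  qed
  have "finite {m. c m \<noteq> 0}" using sub fin by (meson finite_imageI finite_subset)
  moreover have "c m \<in> \<rat>" for m unfolding c_def using c1 c2 by (intro Rats_sum) auto
  moreover have "\<forall>m. c m \<noteq> 0 \<longrightarrow> (\<forall>i. i \<notin> I \<longrightarrow> m i = 0)"
  proof (intro allI impI)
    fix m i assume "c m \<noteq> 0" "i \<notin> I"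
    then obtain m1 m2 where "m = h (m1, m2)" "c1 m1 \<noteq> 0" "c2 m2 \<noteq> 0" using sub by blast
    then show "m i = 0" using c1(3) c2(3) \<open>i \<notin> I\<close> by (simp add: h_def)
  qed
  ultimately show ?case using eq by (intro exI[of _ c]) blast
qed

text \<open>A zero at an algebraically independent point would kill every coefficient, and then
  \<open>f\<close> would vanish at \<open>x\<^sub>0\<close> too. This carries a property from one
  good position to all generic ones.\<close>

lemma ratpoly_nonzero_generic:
  assumes "finite I" "f \<in> ratpoly I" "f x\<^sub>0 \<noteq> 0" "alg_indep_Q x I"
  shows "f x \<noteq> 0"
proof
  assume "f x = 0"
  obtain c where c: "finite {m. c m \<noteq> 0}" "\<forall>m. c m \<in> \<rat>"
      "\<forall>m. c m \<noteq> 0 \<longrightarrow> (\<forall>i. i \<notin> I \<longrightarrow> m i = 0)"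
      "\<And>x. f x = (\<Sum>m\<in>{m. c m \<noteq> 0}. c m * (\<Prod>i\<in>I. x i ^ m i))"
    using ratpoly_coefficients[OF assms(1,2)] by blast
  have "(\<Sum>m\<in>{m. c m \<noteq> 0}. c m * (\<Prod>i\<in>I. x i ^ m i)) = 0"
    using c(4)[of x] \<open>f x = 0\<close> by simp
  then have "\<forall>m. c m = 0"
    using assms(4) c(1-3) unfolding alg_indep_Q_def by blast
  then show False using c(4)[of x\<^sub>0] assms(3) by simp
qed

section \<open>Existence of algebraically independent points\<close>

lemma countable_finite_support:
  assumes "countable A" "countable B"
  shows "countable {f. finite {x. f x \<noteq> z} \<and> (\<forall>x. f x \<noteq> z \<longrightarrow> x \<in> A \<and> f x \<in> B)}" (is "countable ?C")
proof -
  \<comment> \<open>A function is determined by its graph over its support, here a finite subset of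
    a countable set.\<close>
  let ?G = "\<lambda>f. (\<lambda>x. (x, f x)) ` {x. f x \<noteq> z}"
  have "countable {S. S \<subseteq> A \<times> B \<and> finite S}"
    using countable_Collect_finite_subset[OF countable_SIGMA[OF assms]]
    by (simp add: conj_commute)
  moreover have "?G ` ?C \<subseteq> {S. S \<subseteq> A \<times> B \<and> finite S}" by auto
  ultimately have "countable (?G ` ?C)" by (rule countable_subset[rotated])
  moreover have "inj_on ?G ?C"
  proof (rule inj_onI, rule ext)
    fix f g x assume "?G f = ?G g"
    then have "(x, y) \<in> ?G f \<longleftrightarrow> (x, y) \<in> ?G g" for y by simp
    from this[of "f x"] this[of "g x"] show "f x = g x" by auto
  qed
  ultimately show ?thesis by (rule countable_image_inj_on)
qed

lemma countable_rational_coefficients: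
  assumes "finite I"
  shows "countable {c :: ('i \<Rightarrow> nat) \<Rightarrow> real. finite {m. c m \<noteq> 0} \<and> (\<forall>m. c m \<in> \<rat>) \<and>
           (\<forall>m. c m \<noteq> 0 \<longrightarrow> (\<forall>i. i \<notin> I \<longrightarrow> m i = 0))}"
proof -
  let ?M = "{m :: 'i \<Rightarrow> nat. \<forall>i. i \<notin> I \<longrightarrow> m i = 0}"
  have "?M \<subseteq> {m. finite {i. m i \<noteq> 0} \<and> (\<forall>i. m i \<noteq> 0 \<longrightarrow> i \<in> I \<and> m i \<in> UNIV)}"
  proof
    fix m assume "m \<in> ?M"
    then have I: "i \<in> I" if "m i \<noteq> 0" for i using that by (metis (mono_tags) mem_Collect_eq)
    then have "finite {i. m i \<noteq> 0}" by (intro finite_subset[OF _ assms] subsetI) simp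
    with I show "m \<in> {m. finite {i. m i \<noteq> 0} \<and> (\<forall>i. m i \<noteq> 0 \<longrightarrow> i \<in> I \<and> m i \<in> UNIV)}" by simp
  qed
  then have "countable ?M"
    by (rule countable_subset) (rule countable_finite_support[OF countable_finite[OF assms]], simp)
  from countable_finite_support[OF this countable_rat, of 0] show ?thesis
    by (rule countable_subset[rotated]) auto
qed

text \<open>Fixing the coordinates in \<open>I\<close> leaves a univariate polynomial in
  \<open>y\<close>. It is nonzero, since a vanishing coefficient would be a rational relation among
  the coordinates in \<open>I\<close>.\<close>

lemma finite_roots_over_alg_indep:
  assumes I: "finite I" "j \<notin> I" and x: "alg_indep_Q x I"
    and c: "finite {m. c m \<noteq> 0}" "\<forall>m. c m \<in> \<rat>"
      "\<forall>m. c m \<noteq> 0 \<longrightarrow> (\<forall>i. i \<notin> insert j I \<longrightarrow> m i = 0)" "c m\<^sub>0 \<noteq> 0"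
  shows "finite {y. (\<Sum>m\<in>{m. c m \<noteq> 0}. c m * (\<Prod>i\<in>insert j I. (x(j := y)) i ^ m i)) = 0}"
proof -
  let ?S = "{m. c m \<noteq> 0}"
  let ?g = "\<lambda>m. \<Prod>i\<in>I. x i ^ m i"
  define P where "P = (\<Sum>m\<in>?S. Polynomial.monom (c m * ?g m) (m j))"
  have P: "poly P y = (\<Sum>m\<in>?S. c m * (\<Prod>i\<in>insert j I. (x(j := y)) i ^ m i))" for y
  proof -
    have "(\<Prod>i\<in>insert j I. (x(j := y)) i ^ m i) = y ^ m j * ?g m" for m
    proof -
      have "(\<Prod>i\<in>I. (x(j := y)) i ^ m i) = ?g m"
        using I by (intro prod.cong) auto
      then show ?thesis using I by simp
    qed
    then show ?thesis by (simp add: P_def poly_sum poly_monom algebra_simps)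
  qed
  have "P \<noteq> 0"
  proof
    assume "P = 0"
    \<comment> \<open>\<open>c'\<close> collects the terms of \<open>c\<close> of degree
      \<open>n\<close> in the variable \<open>j\<close> and erases that variable, so it describes
      the coefficient of \<open>P\<close> at \<open>n\<close> as a polynomial over
      \<open>I\<close>.\<close>
    define n where "n = m\<^sub>0 j"
    define c' where "c' = (\<lambda>m. if m j = 0 then c (m(j := n)) else 0)"
    let ?S' = "{m. c' m \<noteq> 0}" and ?T = "{m \<in> ?S. m j = n}"
    have bij: "bij_betw (\<lambda>m. m(j := n)) ?S' ?T"
      by (rule bij_betw_byWitness[where f' = "\<lambda>m. m(j := 0)"])
         (auto simp: c'_def fun_upd_idem split: if_splits)
    have "(\<Sum>m\<in>?S'. c' m * ?g m) = (\<Sum>m\<in>?S'. c (m(j := n)) * ?g (m(j := n)))"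
      using I by (intro sum.cong) (auto simp: c'_def intro!: prod.cong split: if_splits)
    also have "\<dots> = (\<Sum>m\<in>?T. c m * ?g m)"
      by (rule sum.reindex_bij_betw[OF bij])
    also have "\<dots> = (\<Sum>m\<in>?S. if m j = n then c m * ?g m else 0)"
      by (rule sum.inter_filter[OF c(1)])
    also have "\<dots> = coeff P n"
      by (simp add: P_def coeff_sum)
    finally have z: "(\<Sum>m\<in>?S'. c' m * ?g m) = 0" using \<open>P = 0\<close> by simp
    have "finite ?S'" using bij_betw_finite[OF bij] c(1) by simp
    moreover have "\<forall>m. c' m \<in> \<rat>" using c(2) by (simp add: c'_def)
    moreover have "\<forall>m. c' m \<noteq> 0 \<longrightarrow> (\<forall>i. i \<notin> I \<longrightarrow> m i = 0)"
    proof (intro allI impI)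
      fix m i assume "c' m \<noteq> 0" "i \<notin> I"
      then have "m j = 0" "c (m(j := n)) \<noteq> 0" by (auto simp: c'_def split: if_splits)
      with c(3) have "\<forall>i. i \<notin> insert j I \<longrightarrow> (m(j := n)) i = 0" by blast
      then show "m i = 0" using \<open>i \<notin> I\<close> \<open>m j = 0\<close> by (cases "i = j") auto
    qed
    ultimately have "\<forall>m. c' m = 0"
      using x z unfolding alg_indep_Q_def by blast
    then have "c' (m\<^sub>0(j := 0)) = 0" by blast
    then show False using c(4) by (simp add: c'_def n_def)
  qed
  then show ?thesis using poly_roots_finite[of P] unfolding P by simp
qed

text \<open>Coordinates are added one at a time: countably many nonzero rational polynomials each
  exclude finitely many values of the new coordinate, and the reals are uncountable.\<close>

lemma alg_indep_Q_exists:
  assumes "finite I"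
  shows "\<exists>x. alg_indep_Q x I"
  using assms
proof induction
  case empty
  have "c m = 0" if c: "\<forall>m. c m \<noteq> 0 \<longrightarrow> (\<forall>i. m i = 0)"
    and s: "(\<Sum>m\<in>{m. c m \<noteq> 0}. c m) = 0" for c :: "('a \<Rightarrow> nat) \<Rightarrow> real" and m
  proof (rule ccontr)
    assume "c m \<noteq> 0"
    then have "m = (\<lambda>_. 0)" using c by auto
    moreover have "{m. c m \<noteq> 0} = {m}" using \<open>c m \<noteq> 0\<close> c \<open>m = (\<lambda>_. 0)\<close> by auto
    ultimately show False using s \<open>c m \<noteq> 0\<close> by simp
  qed
  then have "alg_indep_Q (\<lambda>_. 0) ({} :: 'a set)"
    unfolding alg_indep_Q_def prod.empty mult_1_right by blast
  then show ?case by blast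
next
  case (insert j I)
  then obtain x where x: "alg_indep_Q x I" by blast
  let ?C = "{c :: ('a \<Rightarrow> nat) \<Rightarrow> real. finite {m. c m \<noteq> 0} \<and> (\<forall>m. c m \<in> \<rat>) \<and>
           (\<forall>m. c m \<noteq> 0 \<longrightarrow> (\<forall>i. i \<notin> insert j I \<longrightarrow> m i = 0))}"
  let ?R = "\<lambda>c. {y. (\<Sum>m\<in>{m. c m \<noteq> 0}. c m * (\<Prod>i\<in>insert j I. (x(j := y)) i ^ m i)) = 0}"
  have "countable (\<Union>c\<in>?C - {\<lambda>_. 0}. ?R c)"
  proof (rule countable_UN)
    show "countable (?C - {\<lambda>_. 0})"
      using countable_rational_coefficients[of "insert j I"] insert by simp
    fix c assume c: "c \<in> ?C - {\<lambda>_. 0}"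
    then have "c \<noteq> (\<lambda>_. 0)" by (simp only: Diff_iff singleton_iff not_False_eq_True)
    then have "\<exists>m. c m \<noteq> 0" unfolding fun_eq_iff by blast
    then obtain m where "c m \<noteq> 0" by blast
    then have "finite (?R c)"
      using c insert x by (intro finite_roots_over_alg_indep) auto
    then show "countable (?R c)" by (rule countable_finite)
  qed
  then have "(\<Union>c\<in>?C - {\<lambda>_. 0}. ?R c) \<noteq> UNIV"
    using uncountable_UNIV_real by (intro notI) (simp only:)
  then obtain y where y: "y \<notin> (\<Union>c\<in>?C - {\<lambda>_. 0}. ?R c)"
    unfolding set_eq_iff by blast
  have "alg_indep_Q (x(j := y)) (insert j I)"
    unfolding alg_indep_Q_def
  proof (intro allI impI, elim conjE)
    fix c :: "('a \<Rightarrow> nat) \<Rightarrow> real" and m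
    assume "finite {m. c m \<noteq> 0}" "\<forall>m. c m \<in> \<rat>"
      "\<forall>m. c m \<noteq> 0 \<longrightarrow> (\<forall>i. i \<notin> insert j I \<longrightarrow> m i = 0)"
      "(\<Sum>m\<in>{m. c m \<noteq> 0}. c m * (\<Prod>i\<in>insert j I. (x(j := y)) i ^ m i)) = 0"
    then have "c \<in> ?C" "y \<in> ?R c" by blast+
    with y have "c = (\<lambda>_. 0)" by blast
    then show "c m = 0" by simp
  qed
  then show ?case by blast
qed

section \<open>Generic independence of rows\<close>

text \<open>The Gram matrix is square whatever the number of columns, so a single determinant
  decides independence of the rows without a choice of minor.\<close>

definition gram :: "('c \<Rightarrow> 'b \<Rightarrow> real) \<Rightarrow> 'c list \<Rightarrow> 'b set \<Rightarrow> real mat" where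
  "gram r es K = mat (length es) (length es) (\<lambda>(i, j). \<Sum>c\<in>K. r (es ! i) c * r (es ! j) c)"

text \<open>A dependence of the rows is a kernel vector of the Gram matrix. Conversely, for a kernel
  vector \<open>w\<close> the quadratic form of the matrix at \<open>w\<close> is a sum of squares,
  so the combination of rows with coefficients \<open>w\<close> vanishes in every column.\<close>

lemma det_gram_nonzero_iff:
  assumes "distinct es" "finite K"
  shows "det (gram r es K) \<noteq> 0 \<longleftrightarrow>
    (\<forall>a. (\<forall>c\<in>K. (\<Sum>e\<in>set es. a e * r e c) = 0) \<longrightarrow> (\<forall>e\<in>set es. a e = 0))"
proof -
  define n where "n = length es"
  have G: "gram r es K \<in> carrier_mat n n" by (simp add: gram_def n_def)
  have reindex: "(\<Sum>e\<in>set es. g e) = (\<Sum>j<n. g (es ! j))" for g :: "'a \<Rightarrow> real"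
    using assms(1) by (simp add: n_def sum.reindex_bij_betw[OF bij_betw_nth[OF assms(1) refl refl], symmetric])
  have Gv: "(gram r es K *\<^sub>v w) $ i = (\<Sum>c\<in>K. r (es ! i) c * (\<Sum>j<n. w $ j * r (es ! j) c))"
    if "w \<in> carrier_vec n" "i < n" for w i
  proof -
    have "(gram r es K *\<^sub>v w) $ i = (\<Sum>j<n. (\<Sum>c\<in>K. r (es ! i) c * r (es ! j) c) * w $ j)"
      using that G by (auto simp: gram_def n_def scalar_prod_def lessThan_atLeast0 intro!: sum.cong)
    also have "\<dots> = (\<Sum>j<n. \<Sum>c\<in>K. r (es ! i) c * (w $ j * r (es ! j) c))"
      by (simp add: sum_distrib_right sum_distrib_left algebra_simps)
    also have "\<dots> = (\<Sum>c\<in>K. \<Sum>j<n. r (es ! i) c * (w $ j * r (es ! j) c))"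
      by (rule sum.swap)
    finally show ?thesis by (simp add: sum_distrib_left)
  qed
  show ?thesis
  proof (intro iffI allI impI ballI)
    fix a e
    assume D: "det (gram r es K) \<noteq> 0"
      and a: "\<forall>c\<in>K. (\<Sum>e\<in>set es. a e * r e c) = 0" and e: "e \<in> set es"
    define w where "w = vec n (\<lambda>j. a (es ! j))"
    have w: "w \<in> carrier_vec n" by (simp add: w_def)
    have "(\<Sum>j<n. w $ j * r (es ! j) c) = 0" if "c \<in> K" for c
      using a that by (simp add: w_def reindex)
    then have "(gram r es K *\<^sub>v w) = 0\<^sub>v n"
      using G w by (intro eq_vecI) (auto simp: Gv simp del: index_mult_mat_vec)
    then have "w = 0\<^sub>v n" using D w det_0_iff_vec_prod_zero_field[OF G] by blast
    moreover obtain j where "j < n" "e = es ! j" using e by (auto simp: in_set_conv_nth n_def)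
    ultimately show "a e = 0" by (metis index_vec index_zero_vec(1) w_def)
  next
    assume ind: "\<forall>a. (\<forall>c\<in>K. (\<Sum>e\<in>set es. a e * r e c) = 0) \<longrightarrow> (\<forall>e\<in>set es. a e = 0)"
    show "det (gram r es K) \<noteq> 0"
    proof
      assume "det (gram r es K) = 0"
      then obtain w where w: "w \<in> carrier_vec n" "w \<noteq> 0\<^sub>v n" "gram r es K *\<^sub>v w = 0\<^sub>v n"
        using det_0_iff_vec_prod_zero_field[OF G] by blast
      define s where "s = (\<lambda>c. \<Sum>j<n. w $ j * r (es ! j) c)"
      have "(\<Sum>c\<in>K. s c * s c) = (\<Sum>c\<in>K. \<Sum>i<n. w $ i * (r (es ! i) c * s c))"
        by (subst (2) s_def) (simp add: sum_distrib_left algebra_simps)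
      also have "\<dots> = (\<Sum>i<n. \<Sum>c\<in>K. w $ i * (r (es ! i) c * s c))"
        by (rule sum.swap)
      also have "\<dots> = (\<Sum>i<n. w $ i * (gram r es K *\<^sub>v w) $ i)"
        by (rule sum.cong) (auto simp: Gv[OF w(1)] s_def sum_distrib_left simp del: index_mult_mat_vec)
      also have "\<dots> = 0" using w(3) by simp
      finally have "\<forall>c\<in>K. s c = 0"
        using assms(2) by (subst (asm) sum_nonneg_eq_0_iff) auto
      \<comment> \<open>\<open>w\<close> is indexed by positions in the list; distinctness of
        \<open>es\<close> turns it into a function on its elements.\<close>
      define a where "a = (\<lambda>e. w $ (THE j. j < n \<and> es ! j = e))"
      have a: "a (es ! j) = w $ j" if "j < n" for j
      proof -
        have "(THE j'. j' < n \<and> es ! j' = es ! j) = j"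
          using that assms(1) by (intro the_equality) (auto simp: n_def nth_eq_iff_index_eq)
        then show ?thesis by (simp add: a_def)
      qed
      have "(\<Sum>e\<in>set es. a e * r e c) = s c" for c
        unfolding reindex s_def by (rule sum.cong) (auto simp: a)
      then have "\<forall>e\<in>set es. a e = 0" using ind \<open>\<forall>c\<in>K. s c = 0\<close> by simp
      then have "\<forall>j<n. w $ j = 0" using a by (metis n_def nth_mem)
      then have "w = 0\<^sub>v n" using w(1) by (intro eq_vecI) auto
      then show False using w(2) by simp
    qed
  qed
qed

text \<open>The Leibniz formula builds the determinant from the entries by sums, products and
  signs.\<close>

lemma ratpoly_det_gram:
  assumes "\<And>e c. e \<in> set es \<Longrightarrow> c \<in> K \<Longrightarrow> (\<lambda>x. r x e c) \<in> ratpoly I"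
  shows "(\<lambda>x. det (gram (r x) es K)) \<in> ratpoly I"
proof -
  let ?n = "length es"
  have "(\<lambda>x. \<Sum>\<pi> | \<pi> permutes {0..<?n}. signof \<pi> *
          (\<Prod>i = 0..<?n. \<Sum>c\<in>K. r x (es ! i) c * r x (es ! \<pi> i) c)) \<in> ratpoly I"
  proof (intro ratpoly_sum ratpoly.mult ratpoly_prod)
    fix \<pi> show "(\<lambda>x. signof \<pi>) \<in> ratpoly I" by (rule ratpoly.const) (simp add: sign_def)
  next
    fix \<pi> i c assume "\<pi> \<in> {\<pi>. \<pi> permutes {0..<?n}}" "i \<in> {0..<?n}" "c \<in> K"
    then show "(\<lambda>x. r x (es ! i) c) \<in> ratpoly I" "(\<lambda>x. r x (es ! \<pi> i) c) \<in> ratpoly I"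
      using assms permutes_in_image[of \<pi> "{0..<?n}" i] by auto
  qed
  moreover have "det (gram (r x) es K) = (\<Sum>\<pi> | \<pi> permutes {0..<?n}. signof \<pi> *
          (\<Prod>i = 0..<?n. \<Sum>c\<in>K. r x (es ! i) c * r x (es ! \<pi> i) c))" for x
    unfolding det_def gram_def by (auto intro!: sum.cong prod.cong dest: permutes_in_image)
  ultimately show ?thesis by simp
qed

section \<open>Rows of the rigidity matrix at generic configurations\<close>

lemma simple_graph_finite_edges: "simple_graph V E \<Longrightarrow> finite E"
  by (rule finite_subset[of _ "Pow V"]) (auto simp: simple_graph_def)

lemma simple_graph_subset: "simple_graph V E \<Longrightarrow> F \<subseteq> E \<Longrightarrow> simple_graph V F"
  by (auto simp: simple_graph_def)

lemma simple_graph_edge_at: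
  assumes "simple_graph V E" "e \<in> E" "u \<in> e"
  obtains w where "e = {u, w}" "u \<noteq> w" "u \<in> V" "w \<in> V"
proof -
  obtain a b where "a \<in> V" "b \<in> V" "a \<noteq> b" "e = {a, b}"
    using assms(1,2) unfolding simple_graph_def by blast
  then show ?thesis using assms(3) that[of a] that[of b] by (auto simp: insert_commute)
qed

lemma simple_graph_edgeE:
  assumes "simple_graph V E" "e \<in> E"
  obtains u w where "e = {u, w}" "u \<noteq> w" "u \<in> V" "w \<in> V"
  using bspec[OF conjunct2[OF assms(1)[unfolded simple_graph_def]] assms(2)] by blast

lemma simple_graph_edgeD:
  assumes "simple_graph V E" "{x, w} \<in> E"
  shows "x \<in> V" "w \<in> V" "x \<noteq> w"
proof -
  obtain a b where "{x, w} = {a, b}" "a \<noteq> b" "a \<in> V" "b \<in> V"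
    using assms by (rule simple_graph_edgeE)
  then show "x \<in> V" "w \<in> V" "x \<noteq> w" by (auto simp: doubleton_eq_iff)
qed

lemma rig_row_pair: "x \<noteq> y \<Longrightarrow> rig_row p {x, y} x i = p x i - p y i"
  unfolding rig_row_def by (subst the_equality[where a = y]) auto

lemma rig_row_notin: "x \<notin> e \<Longrightarrow> rig_row p e x i = 0"
  by (simp add: rig_row_def)

text \<open>Independence at \<open>p\<close> makes the Gram determinant, a rational polynomial in
  the coordinates, nonzero at one point and hence at the generic \<open>q\<close>.\<close>

lemma rows_indep_generic:
  assumes "simple_graph V F" "rows_indep k V p F" "generic_config k V q"
  shows "rows_indep k V q F"
proof -
  let ?I = "V \<times> {..<k}"
  \<comment> \<open>The rows are viewed as functions of one flat coordinate vector indexed by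
    \<open>V \<times> {..<k}\<close>, as \<open>alg_indep_Q\<close> expects.\<close>
  define r where "r = (\<lambda>x (e :: 'a set) (u, i). rig_row (\<lambda>u i. x (u, i)) e u i :: real)"
  obtain es where es: "set es = F" "distinct es"
    using finite_distinct_list simple_graph_finite_edges[OF assms(1)] by blast
  have fin: "finite ?I" using assms(1) by (simp add: simple_graph_def)
  have iff: "rows_indep k V p' F \<longleftrightarrow> det (gram (r (\<lambda>(u, i). p' u i)) es ?I) \<noteq> 0" for p'
    unfolding det_gram_nonzero_iff[OF es(2) fin] rows_indep_def es(1) by (auto simp: r_def)
  have "(\<lambda>x. r x e c) \<in> ratpoly ?I" if ec: "e \<in> set es" "c \<in> ?I" for e c
  proof -
    obtain u i where c: "c = (u, i)" "u \<in> V" "i < k" using ec by blast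
    show ?thesis
    proof (cases "u \<in> e")
      case True
      then obtain w where w: "e = {u, w}" "u \<noteq> w" "w \<in> V"
        using assms(1) ec(1) es(1) by (metis simple_graph_edge_at)
      have "(\<lambda>x. r x e c) = (\<lambda>x. x (u, i) - x (w, i))"
        by (simp add: r_def c w rig_row_pair)
      then show ?thesis using w c by (auto intro!: ratpoly_diff ratpoly.var)
    next
      case False
      then have "(\<lambda>x. r x e c) = (\<lambda>x. 0)" by (simp add: r_def c rig_row_notin)
      then show ?thesis by (auto intro: ratpoly.const)
    qed
  qed
  then have "(\<lambda>x. det (gram (r x) es ?I)) \<in> ratpoly ?I" by (rule ratpoly_det_gram)
  from ratpoly_nonzero_generic[OF fin this] show ?thesis
    using assms(2,3) unfolding iff generic_config_def by simp
qed

lemma generic_config_exists: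
  assumes "finite V"
  shows "\<exists>p. generic_config k V p"
proof -
  obtain x where "alg_indep_Q x (V \<times> {..<k})"
    using alg_indep_Q_exists[of "V \<times> {..<k}"] assms by auto
  moreover have "(\<lambda>(u, i). curry x u i) = x" by auto
  ultimately have "generic_config k V (curry x)" by (simp add: generic_config_def)
  then show ?thesis by blast
qed

text \<open>Independence may thus be certified at a convenient special position, such as a lifted or
  projected one.\<close>

lemma rig_indep_iff_exists:
  assumes "simple_graph V F"
  shows "rig_indep k V F \<longleftrightarrow> (\<exists>p. rows_indep k V p F)"
  using assms generic_config_exists[of V k] rows_indep_generic[OF assms]
    simple_graph_finite_edges[OF assms]
  unfolding rig_indep_def simple_graph_def by blast

lemma rig_indep_iff_generic:
  assumes "simple_graph V F" "generic_config k V p"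
  shows "rig_indep k V F \<longleftrightarrow> rows_indep k V p F"
  using rig_indep_iff_exists[OF assms(1)] rows_indep_generic[OF assms(1) _ assms(2)] by blast

lemma generic_config_distinct:
  assumes "finite V" "generic_config k V p" "u \<in> V" "w \<in> V" "u \<noteq> w" "i < k"
  shows "p u i \<noteq> p w i"
proof -
  let ?I = "V \<times> {..<k}"
  have "(\<lambda>x. x (u, i) - x (w, i)) \<in> ratpoly ?I"
    using assms by (intro ratpoly_diff ratpoly.var) auto
  \<comment> \<open>At the indicator of \<open>(u, i)\<close> the difference of the two coordinates
    is 1, so the polynomial is not identically zero.\<close>
  from ratpoly_nonzero_generic[OF _ this, of "\<lambda>c. if c = (u, i) then 1 else 0"] show ?thesis
    using assms unfolding generic_config_def by fastforce
qed

section \<open>Circuits of a space of linear dependences\<close>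

text \<open>\<open>W\<close> plays the space of linear dependences of vectors indexed by
  \<open>X\<close>. Its members are total functions vanishing off \<open>X\<close>, so matroid
  notions become statements about supports. Scalar multiples come from \<open>lincomb\<close>
  applied to the zero function.\<close>

locale stress_space =
  fixes X :: "'b set" and W :: "('b \<Rightarrow> real) set"
  assumes finite_ground: "finite X"
    and zero_outside: "a \<in> W \<Longrightarrow> e \<notin> X \<Longrightarrow> a e = 0"
    and zero_mem: "(\<lambda>_. 0) \<in> W"
    and lincomb: "a \<in> W \<Longrightarrow> b \<in> W \<Longrightarrow> (\<lambda>e. a e + c * b e) \<in> W"
begin

definition indep :: "'b set \<Rightarrow> bool" where
  "indep F \<longleftrightarrow> (\<forall>a\<in>W. (\<forall>e. e \<notin> F \<longrightarrow> a e = 0) \<longrightarrow> (\<forall>e. a e = 0))"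

definition circuit :: "'b set \<Rightarrow> bool" where
  "circuit C \<longleftrightarrow> C \<subseteq> X \<and> \<not> indep C \<and> (\<forall>D. D \<subset> C \<longrightarrow> indep D)"

definition rank :: "'b set \<Rightarrow> nat" where
  "rank F = Max {card I | I. I \<subseteq> F \<and> indep I}"

lemma indep_mono: "indep F \<Longrightarrow> D \<subseteq> F \<Longrightarrow> indep D"
  unfolding indep_def by blast

lemma indep_empty: "indep {}"
  unfolding indep_def by blast

lemma finite_supp: "a \<in> W \<Longrightarrow> finite {e. a e \<noteq> 0}"
  by (rule finite_subset[OF _ finite_ground]) (use zero_outside in blast)

lemma lincomb_sum:
  assumes "finite J" "a \<in> W" "\<And>j. j \<in> J \<Longrightarrow> b j \<in> W"
  shows "(\<lambda>e. a e + (\<Sum>j\<in>J. c j * b j e)) \<in> W"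
  using assms(1,3)
proof induction
  case (insert j J)
  then have "(\<lambda>e. (a e + (\<Sum>j\<in>J. c j * b j e)) + c j * b j e) \<in> W"
    by (intro lincomb) auto
  with insert show ?case by (simp add: algebra_simps)
qed (use assms(2) in simp)

text \<open>A nonzero dependence supported in \<open>C\<close> cannot have smaller support, because
  proper subsets of \<open>C\<close> are independent.\<close>

lemma circuit_stress:
  assumes "circuit C"
  obtains a where "a \<in> W" "{e. a e \<noteq> 0} = C"
proof -
  obtain a where a: "a \<in> W" "\<forall>e. e \<notin> C \<longrightarrow> a e = 0" "\<exists>e. a e \<noteq> 0"
    using assms unfolding circuit_def indep_def by blast
  have "{e. a e \<noteq> 0} = C"
  proof (rule ccontr)
    assume "{e. a e \<noteq> 0} \<noteq> C"
    then have "{e. a e \<noteq> 0} \<subset> C" using a(2) by blast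
    then have "indep {e. a e \<noteq> 0}" using assms unfolding circuit_def by blast
    then show False using a(1,3) unfolding indep_def by blast
  qed
  with a(1) that show ?thesis by blast
qed

text \<open>Among the dependences that are nonzero at \<open>e\<close> and supported where
  \<open>a\<close> is, one of least support has a circuit as its support.\<close>

lemma stress_in_circuit:
  assumes "a \<in> W" "a e \<noteq> 0"
  obtains C where "circuit C" "e \<in> C" "C \<subseteq> {f. a f \<noteq> 0}"
proof -
  let ?P = "\<lambda>b. b \<in> W \<and> b e \<noteq> 0 \<and> {f. b f \<noteq> 0} \<subseteq> {f. a f \<noteq> 0}"
  obtain b where b: "?P b" and min: "\<And>b'. ?P b' \<Longrightarrow> card {f. b f \<noteq> 0} \<le> card {f. b' f \<noteq> 0}"
    using ex_has_least_nat[of ?P a "\<lambda>b. card {f. b f \<noteq> 0}"] assms by blast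
  let ?C = "{f. b f \<noteq> 0}"
  have fin: "finite ?C" using b finite_supp by blast
  have no_smaller: False if "?P b'" "{f. b' f \<noteq> 0} \<subset> ?C" for b'
    using min[OF that(1)] psubset_card_mono[OF fin that(2)] by simp
  have "indep D" if D: "D \<subset> ?C" for D
  proof (rule ccontr)
    assume "\<not> indep D"
    then obtain c f where c: "c \<in> W" "\<forall>e. e \<notin> D \<longrightarrow> c e = 0" "c f \<noteq> 0"
      unfolding indep_def by blast
    have cD: "{f. c f \<noteq> 0} \<subset> ?C" using c D by blast
    show False
    proof (cases "c e = 0")
      case True
      \<comment> \<open>Subtracting a multiple of \<open>c\<close> cancels the value at
        \<open>f\<close> and, as \<open>c e = 0\<close>, keeps the value at \<open>e\<close>: the
        support shrinks.\<close>
      let ?b = "\<lambda>g. b g + (- b f / c f) * c g"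
      have "?b \<in> W" using b c by (intro lincomb) auto
      moreover have "{g. ?b g \<noteq> 0} \<subseteq> ?C - {f}" using cD c(3) by auto
      moreover have "f \<in> ?C" using cD c(3) by blast
      moreover have "?b e \<noteq> 0" using True b by simp
      ultimately show False using no_smaller[of ?b] b by blast
    next
      case False
      then show False using no_smaller[of c] c cD b by blast
    qed
  qed
  moreover have "\<not> indep ?C" using b unfolding indep_def by blast
  moreover have "?C \<subseteq> X" using b zero_outside by blast
  ultimately have "circuit ?C" unfolding circuit_def by blast
  then show ?thesis using that b by blast
qed

text \<open>Combine the dependences of the two circuits so that the values at \<open>x\<close>
  cancel; \<open>e\<close> survives because the second one vanishes there.\<close>

lemma strong_elimination:
  assumes "circuit C\<^sub>1" "circuit C\<^sub>2" "x \<in> C\<^sub>1" "x \<in> C\<^sub>2" "e \<in> C\<^sub>1" "e \<notin> C\<^sub>2"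
  obtains C where "circuit C" "e \<in> C" "C \<subseteq> C\<^sub>1 \<union> C\<^sub>2 - {x}"
proof -
  obtain a b where ab: "a \<in> W" "{e. a e \<noteq> 0} = C\<^sub>1" "b \<in> W" "{e. b e \<noteq> 0} = C\<^sub>2"
    using assms circuit_stress by metis
  let ?c = "\<lambda>g. a g + (- a x / b x) * b g"
  have "?c \<in> W" using ab by (intro lincomb) auto
  moreover have "?c e \<noteq> 0" using ab assms by auto
  ultimately obtain C where "circuit C" "e \<in> C" "C \<subseteq> {g. ?c g \<noteq> 0}"
    by (rule stress_in_circuit)
  moreover have "{g. ?c g \<noteq> 0} \<subseteq> C\<^sub>1 \<union> C\<^sub>2 - {x}" using ab assms by auto
  ultimately show ?thesis using that by blast
qed

lemma circuit_finite: "circuit C \<Longrightarrow> finite C"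
  unfolding circuit_def using finite_ground finite_subset by blast

lemma circuit_subset_eq: "circuit C \<Longrightarrow> circuit D \<Longrightarrow> C \<subseteq> D \<Longrightarrow> C = D"
  unfolding circuit_def by blast

text \<open>This is transitivity of sharing a circuit. Eliminating \<open>x\<close> while keeping
  \<open>e\<close> gives \<open>C\<^sub>3\<close>, which contains some \<open>y\<close> in
  \<open>C\<^sub>2\<close> outside \<open>C\<^sub>1\<close>; eliminating \<open>y\<close> from
  \<open>C\<^sub>2\<close> and \<open>C\<^sub>3\<close> while keeping \<open>f\<close> gives
  \<open>C\<^sub>4\<close>. It still meets \<open>C\<^sub>1\<close>, and the pair
  \<open>C\<^sub>1\<close>, \<open>C\<^sub>4\<close> has a smaller union.\<close>

lemma common_circuit_of_meeting:
  assumes "circuit C\<^sub>1" "circuit C\<^sub>2" "e \<in> C\<^sub>1" "f \<in> C\<^sub>2" "C\<^sub>1 \<inter> C\<^sub>2 \<noteq> {}"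
  shows "\<exists>C. circuit C \<and> e \<in> C \<and> f \<in> C"
  using assms
proof (induction "card (C\<^sub>1 \<union> C\<^sub>2)" arbitrary: C\<^sub>1 C\<^sub>2 rule: less_induct)
  case less
  show ?case
  proof (rule ccontr)
    assume none: "\<not> ?case"
    have fin: "finite (C\<^sub>1 \<union> C\<^sub>2)"
      using less.prems circuit_finite by blast
    obtain x where x: "x \<in> C\<^sub>1" "x \<in> C\<^sub>2" using less.prems by blast
    have "e \<notin> C\<^sub>2" using none less.prems by blast
    with less.prems(1,2) x less.prems(3) obtain C\<^sub>3 where C3: "circuit C\<^sub>3" "e \<in> C\<^sub>3" "C\<^sub>3 \<subseteq> C\<^sub>1 \<union> C\<^sub>2 - {x}"
      by (rule strong_elimination)
    have "\<not> C\<^sub>3 \<subseteq> C\<^sub>1" using circuit_subset_eq[OF C3(1) less.prems(1)] C3(3) x by blast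
    then obtain y where y: "y \<in> C\<^sub>3" "y \<in> C\<^sub>2" "y \<notin> C\<^sub>1" using C3(3) by blast
    have "\<not> C\<^sub>3 \<union> C\<^sub>2 \<subset> C\<^sub>1 \<union> C\<^sub>2"
      using less.hyps[OF psubset_card_mono[OF fin] C3(1) less.prems(2) C3(2) less.prems(4)] none y
      by blast
    then have sub: "C\<^sub>1 - C\<^sub>2 \<subseteq> C\<^sub>3" using C3(3) by blast
    have "f \<notin> C\<^sub>3" using none C3 by blast
    with less.prems(2) C3(1) y(2,1) less.prems(4) obtain C\<^sub>4 where C4: "circuit C\<^sub>4" "f \<in> C\<^sub>4" "C\<^sub>4 \<subseteq> C\<^sub>2 \<union> C\<^sub>3 - {y}"
      by (rule strong_elimination)
    have "\<not> C\<^sub>4 \<subseteq> C\<^sub>2" using circuit_subset_eq[OF C4(1) less.prems(2)] C4(3) y by blast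
    then have "C\<^sub>1 \<inter> C\<^sub>4 \<noteq> {}" using C4(3) C3(3) by blast
    moreover have "C\<^sub>1 \<union> C\<^sub>4 \<subset> C\<^sub>1 \<union> C\<^sub>2" using C4(3) C3(3) y by blast
    ultimately show False
      using less.hyps[OF psubset_card_mono[OF fin] less.prems(1) C4(1) less.prems(3) C4(2)] none
      by blast
  qed
qed

text \<open>When \<open>J\<close> spans everything except possibly \<open>e\<close>, any dependence
  using \<open>e\<close> can be cleared outside \<open>insert e J\<close>. It serves both for basis
  exchange and for bringing dependences down from the cone.\<close>

lemma dependent_insert_of_stress:
  assumes J: "indep J" "e \<notin> J" and a: "a \<in> W" "a e \<noteq> 0"
    and span: "\<And>f. f \<in> X - J - {e} \<Longrightarrow> \<not> indep (insert f J)"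
  shows "\<not> indep (insert e J)"
proof -
  let ?X = "X - J - {e}"
  have "\<exists>s\<in>W. (\<forall>g. g \<notin> insert f J \<longrightarrow> s g = 0) \<and> s f = 1" if f: "f \<in> ?X" for f
  proof -
    obtain s where s: "s \<in> W" "\<forall>g. g \<notin> insert f J \<longrightarrow> s g = 0" "\<exists>g. s g \<noteq> 0"
      using span[OF f] unfolding indep_def by blast
    have "s f \<noteq> 0"
    proof
      assume "s f = 0"
      then have "\<forall>g. g \<notin> J \<longrightarrow> s g = 0" using s(2) by (metis insert_iff)
      then show False using J(1) s unfolding indep_def by blast
    qed
    moreover have "(\<lambda>g. 0 + (1 / s f) * s g) \<in> W" using s by (intro lincomb zero_mem)
    ultimately show ?thesis using s(2) by (intro bexI) auto
  qed
  then obtain s where s: "\<And>f. f \<in> ?X \<Longrightarrow> s f \<in> W"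
    "\<And>f g. f \<in> ?X \<Longrightarrow> g \<notin> insert f J \<Longrightarrow> s f g = 0" "\<And>f. f \<in> ?X \<Longrightarrow> s f f = 1"
    by metis
  \<comment> \<open>Each \<open>s f\<close> is normalised to 1 at \<open>f\<close> and vanishes at
    \<open>e\<close>, so \<open>b\<close> is zero throughout \<open>?X\<close> and agrees with
    \<open>a\<close> at \<open>e\<close>.\<close>
  define b where "b = (\<lambda>g. a g + (\<Sum>f\<in>?X. - a f * s f g))"
  have fin: "finite ?X" using finite_ground by simp
  have "b \<in> W" unfolding b_def using fin a s by (intro lincomb_sum) auto
  moreover have "b g = 0" if g: "g \<notin> insert e J" for g
  proof (cases "g \<in> X")
    case True
    have "(\<Sum>f\<in>?X. - a f * s f g) = (\<Sum>f\<in>?X. if f = g then - a g else 0)"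
      using g s by (intro sum.cong) auto
    then show ?thesis using fin g True by (simp add: b_def)
  next
    case False
    then show ?thesis using s(1) zero_outside a(1) by (simp add: b_def sum.neutral)
  qed
  moreover have "b e \<noteq> 0"
  proof -
    have "(\<Sum>f\<in>?X. - a f * s f e) = 0" using s(2) J(2) by (intro sum.neutral) auto
    then show ?thesis using a by (simp add: b_def)
  qed
  ultimately show ?thesis unfolding indep_def by blast
qed

section \<open>Rank and coloops\<close>

lemma rank_ge:
  assumes "I \<subseteq> F" "F \<subseteq> X" "indep I"
  shows "card I \<le> rank F"
  unfolding rank_def
proof (rule Max_ge)
  have "finite (Pow F)" using assms(2) finite_ground finite_subset by blast
  then show "finite {card I | I. I \<subseteq> F \<and> indep I}"
    by (rule finite_surj[where f = card]) auto
qed (use assms in blast)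

lemma rank_attained:
  assumes "F \<subseteq> X"
  obtains I where "I \<subseteq> F" "indep I" "card I = rank F"
proof -
  have "finite (Pow F)" using assms finite_ground finite_subset by blast
  then have "finite {card I | I. I \<subseteq> F \<and> indep I}"
    by (rule finite_surj[where f = card]) auto
  moreover have "{card I | I. I \<subseteq> F \<and> indep I} \<noteq> {}" using indep_empty by blast
  ultimately have "rank F \<in> {card I | I. I \<subseteq> F \<and> indep I}"
    unfolding rank_def by (rule Max_in)
  then show ?thesis using that by auto
qed

text \<open>An element used by no dependence extends every independent set avoiding it. An element
  used by some dependence can be exchanged out of a basis, so deleting it keeps the rank.
  Independence of \<open>{e}\<close> makes the rank positive, so the subtraction is not
  truncated.\<close>

lemma rank_drop_iff_unstressed:
  assumes "e \<in> X" "indep {e}"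
  shows "rank (X - {e}) = rank X - 1 \<longleftrightarrow> (\<forall>a\<in>W. a e = 0)"
proof
  assume *: "\<forall>a\<in>W. a e = 0"
  obtain I where I: "I \<subseteq> X - {e}" "indep I" "card I = rank (X - {e})"
    by (rule rank_attained[of "X - {e}"]) auto
  have "indep (insert e I)" unfolding indep_def
  proof (intro ballI impI)
    fix a assume a: "a \<in> W" "\<forall>g. g \<notin> insert e I \<longrightarrow> a g = 0"
    then have "\<forall>g. g \<notin> I \<longrightarrow> a g = 0" using * by (metis insert_iff)
    then show "\<forall>g. a g = 0" using I(2) a(1) unfolding indep_def by blast
  qed
  then have "card (insert e I) \<le> rank X" using I assms(1) by (intro rank_ge) auto
  moreover have "card (insert e I) = Suc (card I)"
    using I(1) finite_subset[OF _ finite_ground] by (subst card_insert_disjoint) auto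
  moreover obtain B where B: "B \<subseteq> X" "indep B" "card B = rank X"
    by (rule rank_attained[of X]) auto
  have "card (B - {e}) \<le> rank (X - {e})"
    using B by (intro rank_ge indep_mono[OF B(2)]) auto
  then have "rank X - 1 \<le> rank (X - {e})"
    using B(3) card_Diff1_le[of B e] by (cases "e \<in> B") (simp_all add: card_Diff_singleton_if)
  ultimately show "rank (X - {e}) = rank X - 1" using I(3) by linarith
next
  assume drop: "rank (X - {e}) = rank X - 1"
  have pos: "rank X \<ge> 1" using rank_ge[of "{e}" X] assms by simp
  show "\<forall>a\<in>W. a e = 0"
  proof (rule ccontr)
    assume "\<not> (\<forall>a\<in>W. a e = 0)"
    then obtain a where a: "a \<in> W" "a e \<noteq> 0" by blast
    obtain B where B: "B \<subseteq> X" "indep B" "card B = rank X"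
      by (rule rank_attained[of X]) auto
    have fin: "finite B" using B(1) finite_ground finite_subset by blast
    have "\<exists>B'. B' \<subseteq> X - {e} \<and> indep B' \<and> card B' = rank X"
    proof (cases "e \<in> B")
      case True
      let ?J = "B - {e}"
      \<comment> \<open>If no replacement \<open>f\<close> existed,
        \<open>dependent_insert_of_stress\<close> would make \<open>B\<close> dependent.\<close>
      have "\<exists>f\<in>X - ?J - {e}. indep (insert f ?J)"
        using dependent_insert_of_stress[of ?J e a] a B True indep_mono[OF B(2), of ?J]
        by (auto simp: insert_absorb)
      then obtain f where f: "f \<in> X - ?J - {e}" "indep (insert f ?J)" by blast
      have "card (insert f ?J) = card B"
        using f True fin by (metis DiffE card_Suc_Diff1 card_insert_disjoint finite_Diff)
      then show ?thesis using f B by (intro exI[of _ "insert f ?J"]) auto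
    next
      case False
      then show ?thesis using B by blast
    qed
    then obtain B' where "B' \<subseteq> X - {e}" "indep B'" "card B' = rank X" by blast
    then have "rank X \<le> rank (X - {e})" using rank_ge[of B' "X - {e}"] by simp
    then show False using drop pos by linarith
  qed
qed

end

section \<open>Stresses\<close>

text \<open>These are the equilibrium stresses of the framework, the left kernel of the rigidity
  matrix. Extension by zero makes stresses of a subgraph stresses of the whole graph.\<close>

definition stresses :: "nat \<Rightarrow> 'a set \<Rightarrow> ('a \<Rightarrow> nat \<Rightarrow> real) \<Rightarrow> 'a set set \<Rightarrow> ('a set \<Rightarrow> real) set" where
  "stresses k V p E = {a. (\<forall>e. e \<notin> E \<longrightarrow> a e = 0) \<and>
     (\<forall>x\<in>V. \<forall>i<k. (\<Sum>e\<in>E. a e * rig_row p e x i) = 0)}"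

lemma stress_space_stresses:
  assumes "simple_graph V E"
  shows "stress_space E (stresses k V p E)"
proof
  show "finite E" by (rule simple_graph_finite_edges[OF assms])
next
  fix a b c assume "a \<in> stresses k V p E" "b \<in> stresses k V p E"
  then show "(\<lambda>e. a e + c * b e) \<in> stresses k V p E"
    by (auto simp: stresses_def algebra_simps sum.distrib simp flip: sum_distrib_left)
qed (auto simp: stresses_def)

lemma stresses_subgraph:
  assumes "finite E" "F \<subseteq> E"
  shows "a \<in> stresses k V p F \<longleftrightarrow> a \<in> stresses k V p E \<and> (\<forall>e. e \<notin> F \<longrightarrow> a e = 0)"
proof -
  have "(\<Sum>e\<in>F. a e * rig_row p e x i) = (\<Sum>e\<in>E. a e * rig_row p e x i)"
    if "\<forall>e. e \<notin> F \<longrightarrow> a e = 0" for x i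
    using assms that by (intro sum.mono_neutral_left) auto
  then show ?thesis using assms(2) unfolding stresses_def by auto
qed

lemma rows_indep_iff_stresses:
  "rows_indep k V p F \<longleftrightarrow> (\<forall>a\<in>stresses k V p F. \<forall>e. a e = 0)"
proof (intro iffI ballI)
  fix a assume "rows_indep k V p F" "a \<in> stresses k V p F"
  then show "\<forall>e. a e = 0" unfolding rows_indep_def stresses_def by blast
next
  assume *: "\<forall>a\<in>stresses k V p F. \<forall>e. a e = 0"
  show "rows_indep k V p F" unfolding rows_indep_def
  proof (intro allI impI ballI)
    fix a e
    assume a: "\<forall>x\<in>V. \<forall>i<k. (\<Sum>e\<in>F. a e * rig_row p e x i) = 0" and e: "e \<in> F"
    have "(\<Sum>e\<in>F. (if e \<in> F then a e else 0) * rig_row p e x i) = (\<Sum>e\<in>F. a e * rig_row p e x i)" for x i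
      by (rule sum.cong) auto
    then have "(\<lambda>e. if e \<in> F then a e else 0) \<in> stresses k V p F"
      using a unfolding stresses_def by simp
    from bspec[OF * this] e show "a e = 0" by metis
  qed
qed

text \<open>One generic \<open>p\<close> works for all edge subsets at once, so the rigidity matroid
  is that of a single stress space.\<close>

lemma rig_indep_iff_stress_indep:
  assumes "simple_graph V E" "generic_config k V p" "F \<subseteq> E"
  shows "rig_indep k V F \<longleftrightarrow> stress_space.indep (stresses k V p E) F"
  unfolding rig_indep_iff_generic[OF simple_graph_subset[OF assms(1,3)] assms(2)]
    rows_indep_iff_stresses stress_space.indep_def[OF stress_space_stresses[OF assms(1)]]
    Ball_def stresses_subgraph[OF simple_graph_finite_edges[OF assms(1)] assms(3)]
  by blast

lemma rig_circuit_iff_stress_circuit: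
  assumes "simple_graph V E" "generic_config k V p"
  shows "rig_circuit k V E C \<longleftrightarrow> stress_space.circuit E (stresses k V p E) C"
proof -
  interpret stress_space E "stresses k V p E" by (rule stress_space_stresses[OF assms(1)])
  show ?thesis
    using rig_indep_iff_stress_indep[OF assms] unfolding rig_circuit_def circuit_def
    by (metis psubset_imp_subset subset_trans)
qed

lemma rig_rank_eq_stress_rank:
  assumes "simple_graph V E" "generic_config k V p" "F \<subseteq> E"
  shows "rig_rank k V F = stress_space.rank (stresses k V p E) F"
proof -
  interpret stress_space E "stresses k V p E" by (rule stress_space_stresses[OF assms(1)])
  have "{card I | I. I \<subseteq> F \<and> rig_indep k V I} = {card I | I. I \<subseteq> F \<and> indep I}"
    using rig_indep_iff_stress_indep[OF assms(1,2)] assms(3) by (metis subset_trans)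
  then show ?thesis unfolding rig_rank_def rank_def by simp
qed

lemma M_bridge_iff_unstressed:
  assumes "simple_graph V E" "generic_config k V p" "1 \<le> k" "e \<in> E"
  shows "M_bridge k V E e \<longleftrightarrow> (\<forall>a\<in>stresses k V p E. a e = 0)"
proof -
  interpret stress_space E "stresses k V p E" by (rule stress_space_stresses[OF assms(1)])
  obtain u w where e: "e = {u, w}" "u \<noteq> w" "u \<in> V" "w \<in> V"
    using assms(1,4) by (rule simple_graph_edgeE)
  \<comment> \<open>A single row is nonzero already in coordinate 0, which exists because
    \<open>1 \<le> k\<close>.\<close>
  have "p u 0 \<noteq> p w 0"
    using generic_config_distinct[OF _ assms(2) e(3,4,2)] assms(1,3) by (simp add: simple_graph_def)
  then have "rows_indep k V p {e}"
    using e assms(3) unfolding rows_indep_def by (fastforce simp: rig_row_pair)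
  then have "indep {e}"
    using assms rig_indep_iff_generic[OF simple_graph_subset[OF assms(1)] assms(2), of "{e}"]
      rig_indep_iff_stress_indep[OF assms(1,2), of "{e}"] by simp
  then show ?thesis
    using rank_drop_iff_unstressed[OF assms(4)] assms rig_rank_eq_stress_rank[OF assms(1,2)]
    unfolding M_bridge_def by auto
qed

lemma sum_rig_row_neighbours:
  assumes "simple_graph V E"
  shows "(\<Sum>e\<in>E. a e * rig_row p e x i) = (\<Sum>w | {x, w} \<in> E. a {x, w} * (p x i - p w i))"
proof -
  have "(\<Sum>e\<in>E. a e * rig_row p e x i) = (\<Sum>e\<in>{e\<in>E. x \<in> e}. a e * rig_row p e x i)"
    using simple_graph_finite_edges[OF assms]
    by (intro sum.mono_neutral_right) (auto simp: rig_row_notin)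
  also have "{e\<in>E. x \<in> e} = (\<lambda>w. {x, w}) ` {w. {x, w} \<in> E}"
  proof (intro equalityI subsetI)
    fix e assume "e \<in> {e\<in>E. x \<in> e}"
    then obtain w where "e = {x, w}" "e \<in> E" using simple_graph_edge_at[OF assms] by blast
    then show "e \<in> (\<lambda>w. {x, w}) ` {w. {x, w} \<in> E}" by blast
  qed auto
  also have "(\<Sum>e\<in>\<dots>. a e * rig_row p e x i) = (\<Sum>w | {x, w} \<in> E. a {x, w} * rig_row p {x, w} x i)"
    by (rule sum.reindex_cong[OF _ refl refl]) (auto simp: inj_on_def doubleton_eq_iff)
  also have "\<dots> = (\<Sum>w | {x, w} \<in> E. a {x, w} * (p x i - p w i))"
    using simple_graph_edgeD[OF assms] by (intro sum.cong) (auto simp: rig_row_pair)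
  finally show ?thesis .
qed

text \<open>Each row has opposite entries at its two endpoints. Hence equilibrium at all vertices
  but one implies it at the last, which is used for the apex.\<close>

lemma sum_rig_row_vertices:
  assumes "simple_graph V E"
  shows "(\<Sum>x\<in>V. \<Sum>e\<in>E. a e * rig_row p e x i) = 0"
proof -
  have "(\<Sum>x\<in>V. rig_row p e x i) = 0" if "e \<in> E" for e
  proof -
    obtain u w where e: "e = {u, w}" "u \<noteq> w" "u \<in> V" "w \<in> V"
      using assms \<open>e \<in> E\<close> by (rule simple_graph_edgeE)
    have "(\<Sum>x\<in>V. rig_row p e x i) = (\<Sum>x\<in>{u, w}. rig_row p e x i)"
      using assms e by (intro sum.mono_neutral_right) (auto simp: simple_graph_def rig_row_notin)
    also have "\<dots> = 0"
      using e rig_row_pair[of u w p i] rig_row_pair[of w u p i] by (simp add: insert_commute)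
    finally show ?thesis .
  qed
  then have "(\<Sum>e\<in>E. a e * (\<Sum>x\<in>V. rig_row p e x i)) = 0" by simp
  then show ?thesis by (subst sum.swap) (simp add: sum_distrib_left)
qed

section \<open>Coning\<close>

lemma simple_graph_cone:
  assumes "simple_graph V E" "v \<notin> V" "U \<subseteq> V"
  shows "simple_graph (insert v V) (cone_edges U E v)"
  unfolding simple_graph_def
proof (intro conjI ballI)
  fix e assume "e \<in> cone_edges U E v"
  then consider "e \<in> E" | u where "u \<in> U" "e = {u, v}" by (auto simp: cone_edges_def)
  then show "\<exists>a b. a \<in> insert v V \<and> b \<in> insert v V \<and> a \<noteq> b \<and> e = {a, b}"
  proof cases
    case 1
    then show ?thesis using assms(1) unfolding simple_graph_def by blast
  next
    case 2
    then show ?thesis using assms(2,3) by (intro exI[of _ u] exI[of _ v]) auto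
  qed
qed (use assms in \<open>simp add: simple_graph_def\<close>)

lemma spoke_notin:
  assumes "simple_graph V E" "v \<notin> V"
  shows "{u, v} \<notin> E"
proof
  assume "{u, v} \<in> E"
  then show False using simple_graph_edgeD(2)[OF assms(1)] assms(2) by blast
qed

text \<open>p is the central projection of q from the apex: q u - q v = t u * (p u, 1).\<close>
locale cone_config =
  fixes V :: "'a set" and v :: 'a and d :: nat
    and q p :: "'a \<Rightarrow> nat \<Rightarrow> real" and t :: "'a \<Rightarrow> real"
  assumes finite_V: "finite V" and apex: "v \<notin> V"
    and low: "u \<in> V \<Longrightarrow> i < d \<Longrightarrow> q u i - q v i = t u * p u i"
    and top: "u \<in> V \<Longrightarrow> q u d - q v d = t u"
    and t_nonzero: "u \<in> V \<Longrightarrow> t u \<noteq> 0"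
begin

text \<open>Away from the apex a vertex gains at most the neighbour \<open>v\<close>. Spokes go only
  to \<open>U\<close>, so that the cone over a circuit can be restricted to its own
  vertices.\<close>

lemma cone_equilibrium:
  assumes F: "simple_graph V F" and U: "U \<subseteq> V" and x: "x \<in> V"
  shows "(\<Sum>e\<in>cone_edges U F v. a e * rig_row q e x i) =
    (\<Sum>w | {x, w} \<in> F. a {x, w} * (q x i - q w i)) + (if x \<in> U then a {x, v} * (q x i - q v i) else 0)"
proof -
  let ?N = "{w. {x, w} \<in> F}"
  have "?N \<subseteq> V" using simple_graph_edgeD[OF F] by blast
  then have fin: "finite ?N" using finite_V finite_subset by blast
  have v: "v \<notin> ?N" using spoke_notin[OF F apex] by blast
  have "{w. {x, w} \<in> cone_edges U F v} = (if x \<in> U then insert v ?N else ?N)"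
    using x apex U by (auto simp: cone_edges_def doubleton_eq_iff)
  then show ?thesis
    using sum_rig_row_neighbours[OF simple_graph_cone[OF F apex U], of a q x i] fin v by auto
qed

text \<open>This is the change of stresses under central projection: an edge \<open>uw\<close> picks
  up the factor \<open>t u * t w\<close>, and spokes are dropped.\<close>

definition scale :: "'a set set \<Rightarrow> ('a set \<Rightarrow> real) \<Rightarrow> 'a set \<Rightarrow> real" where
  "scale F a e = (if e \<in> F then a e * (\<Prod>u\<in>e. t u) else 0)"

text \<open>The last coordinate of equilibrium sees only the heights, so it determines the spoke
  coefficient at \<open>x\<close> from the edges of \<open>F\<close>.\<close>

lemma spoke_stress:
  assumes F: "simple_graph V F" and U: "U \<subseteq> V" and x: "x \<in> V"
    and a: "a \<in> stresses (d + 1) (insert v V) q (cone_edges U F v)"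
  shows "(\<Sum>w | {x, w} \<in> F. a {x, w} * (t x - t w)) + (if x \<in> U then a {x, v} * t x else 0) = 0"
proof -
  have "(\<Sum>w | {x, w} \<in> F. a {x, w} * (q x d - q w d)) = (\<Sum>w | {x, w} \<in> F. a {x, w} * (t x - t w))"
    using simple_graph_edgeD[OF F] top x by (intro sum.cong) (auto simp flip: top)
  then show ?thesis
    using a x cone_equilibrium[OF F U x, of a d] unfolding stresses_def
    by (simp add: top[OF x] split: if_splits)
qed

text \<open>Subtracting \<open>p x i\<close> times the last-coordinate equation from equation
  \<open>i\<close> cancels the spoke and leaves terms
  \<open>a {x, w} * t w * (p x i - p w i)\<close>; multiplying by \<open>t x\<close> gives
  equilibrium in dimension \<open>d\<close>.\<close>

lemma scale_stress:
  assumes F: "simple_graph V F" and U: "U \<subseteq> V"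
    and a: "a \<in> stresses (d + 1) (insert v V) q (cone_edges U F v)"
  shows "scale F a \<in> stresses d V p F"
proof -
  have "(\<Sum>w | {x, w} \<in> F. scale F a {x, w} * (p x i - p w i)) = 0" if x: "x \<in> V" and i: "i < d" for x i
  proof -
    let ?s = "if x \<in> U then a {x, v} * t x else 0"
    have "(\<Sum>w | {x, w} \<in> F. a {x, w} * (q x i - q w i)) = (\<Sum>w | {x, w} \<in> F. a {x, w} * (t x * p x i - t w * p w i))"
      using simple_graph_edgeD[OF F] x i by (intro sum.cong) (auto simp flip: low)
    then have 1: "(\<Sum>w | {x, w} \<in> F. a {x, w} * (t x * p x i - t w * p w i)) + ?s * p x i = 0"
      using a x i cone_equilibrium[OF F U x, of a i] low[OF x i] unfolding stresses_def by (auto simp: algebra_simps)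
    have "(\<Sum>w | {x, w} \<in> F. scale F a {x, w} * (p x i - p w i)) =
        (\<Sum>w | {x, w} \<in> F. t x * (a {x, w} * (t x * p x i - t w * p w i) - p x i * (a {x, w} * (t x - t w))))"
      using simple_graph_edgeD[OF F] by (intro sum.cong) (auto simp: scale_def algebra_simps)
    also have "\<dots> = t x * ((\<Sum>w | {x, w} \<in> F. a {x, w} * (t x * p x i - t w * p w i))
        - p x i * (\<Sum>w | {x, w} \<in> F. a {x, w} * (t x - t w)))"
      by (simp only: sum_distrib_left[symmetric] sum_subtractf)
    also have "\<dots> = t x * (- ?s * p x i - p x i * (- ?s))"
    proof -
      have "(\<Sum>w | {x, w} \<in> F. a {x, w} * (t x * p x i - t w * p w i)) = - ?s * p x i"
        using 1 by linarith
      moreover have "(\<Sum>w | {x, w} \<in> F. a {x, w} * (t x - t w)) = - ?s"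
        using spoke_stress[OF F U x a] by linarith
      ultimately show ?thesis by (simp only:)
    qed
    finally show ?thesis by simp
  qed
  then show ?thesis
    unfolding stresses_def sum_rig_row_neighbours[OF F] by (simp add: scale_def)
qed

text \<open>This is injectivity of \<open>scale F\<close> on cone stresses: the heights are nonzero,
  and the spokes are determined by the edges of \<open>F\<close>.\<close>

lemma cone_stress_zero:
  assumes F: "simple_graph V F" and U: "U \<subseteq> V"
    and a: "a \<in> stresses (d + 1) (insert v V) q (cone_edges U F v)"
    and zero: "\<And>e. scale F a e = 0"
  shows "a e = 0"
proof -
  have aF: "a e = 0" if "e \<in> F" for e
  proof -
    have "e \<subseteq> V" "finite e" using F that unfolding simple_graph_def by auto
    then have "(\<Prod>u\<in>e. t u) \<noteq> 0" using t_nonzero by auto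
    then show ?thesis using zero[of e] that by (simp add: scale_def)
  qed
  have "a {x, v} = 0" if "x \<in> U" for x
  proof -
    have x: "x \<in> V" using that U by blast
    show ?thesis using spoke_stress[OF F U x a] that aF t_nonzero[OF x] by simp
  qed
  moreover have "a e = 0" if "e \<notin> cone_edges U F v" using a that unfolding stresses_def by blast
  ultimately show ?thesis using aF unfolding cone_edges_def by blast
qed

lemma rows_indep_cone:
  assumes F: "simple_graph V F" "U \<subseteq> V" and "rows_indep d V p F"
  shows "rows_indep (d + 1) (insert v V) q (cone_edges U F v)"
  using assms(3) scale_stress[OF F] cone_stress_zero[OF F] unfolding rows_indep_iff_stresses by blast

text \<open>This is surjectivity of \<open>scale F\<close>. As \<open>U\<close> covers all endpoints
  of \<open>F\<close>, every loaded vertex has a spoke to balance it, and equilibrium at the apex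
  follows from the others.\<close>

lemma lift_stress:
  assumes F: "simple_graph V F" and U: "\<Union>F \<subseteq> U" "U \<subseteq> V" and b: "b \<in> stresses d V p F"
  shows "\<exists>a\<in>stresses (d + 1) (insert v V) q (cone_edges U F v). scale F a = b"
proof -
  \<comment> \<open>\<open>c\<close> undoes the scaling, and \<open>s\<close> is the spoke
    coefficient forced by equilibrium in the last coordinate.\<close>
  define c where "c = (\<lambda>e. b e / (\<Prod>u\<in>e. t u))"
  define s where "s = (\<lambda>x. - (\<Sum>w | {x, w} \<in> F. c {x, w} * (t x - t w)) / t x)"
  define a where "a = (\<lambda>e. if e \<in> F then c e else if e \<in> cone_edges U F v then s (THE x. e = {x, v}) else 0)"
  have aF: "a e = c e" if "e \<in> F" for e using that by (simp add: a_def)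
  have aS: "a {x, v} = s x" if "x \<in> U" for x
  proof -
    have "(THE y. {x, v} = {y, v}) = x" by (rule the_equality) (auto simp: doubleton_eq_iff)
    then show ?thesis using that spoke_notin[OF F apex] by (auto simp: a_def cone_edges_def)
  qed
  have eq: "(\<Sum>e\<in>cone_edges U F v. a e * rig_row q e x i) = 0" if x: "x \<in> V" and i: "i < d + 1" for x i
  proof (cases "x \<in> U")
    case True
    let ?P = "\<Sum>w | {x, w} \<in> F. c {x, w} * (t x - t w)"
    have s: "s x * t x = - ?P" using t_nonzero[OF x] by (simp add: s_def)
    show ?thesis
    proof (cases "i = d")
      case i: True
      have "(\<Sum>w | {x, w} \<in> F. a {x, w} * (q x i - q w i)) = ?P"
        using simple_graph_edgeD[OF F] x i by (intro sum.cong) (auto simp: aF simp flip: top)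
      then show ?thesis
        using cone_equilibrium[OF F U(2) x, of a i] True s i top[OF x] by (simp add: aS)
    next
      case False
      then have i: "i < d" using i by simp
      have b0: "(\<Sum>w | {x, w} \<in> F. b {x, w} * (p x i - p w i)) = 0"
        using b x i unfolding stresses_def sum_rig_row_neighbours[OF F] by blast
      \<comment> \<open>This splits \<open>t x * p x i - t w * p w i\<close> as
        \<open>t w * (p x i - p w i) + p x i * (t x - t w)\<close>; the first part sums to zero as
        \<open>b\<close> is a stress.\<close>
      have "(\<Sum>w | {x, w} \<in> F. a {x, w} * (q x i - q w i)) =
          (\<Sum>w | {x, w} \<in> F. b {x, w} * (p x i - p w i) / t x + p x i * (c {x, w} * (t x - t w)))"
      proof (rule sum.cong[OF refl])
        fix w assume "w \<in> {w. {x, w} \<in> F}"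
        then have w: "{x, w} \<in> F" "w \<in> V" "x \<noteq> w" using simple_graph_edgeD[OF F] by auto
        then have "b {x, w} = c {x, w} * (t x * t w)"
          using t_nonzero x by (simp add: c_def)
        moreover have "q x i - q w i = t x * p x i - t w * p w i"
          using low[OF x i] low[OF w(2) i] by simp
        ultimately show "a {x, w} * (q x i - q w i) =
            b {x, w} * (p x i - p w i) / t x + p x i * (c {x, w} * (t x - t w))"
          using t_nonzero[OF x] by (simp only: aF[OF w(1)]) (simp add: field_simps)
      qed
      also have "\<dots> = p x i * ?P"
        using b0 by (simp add: sum.distrib sum_distrib_left flip: sum_divide_distrib)
      finally have "(\<Sum>e\<in>cone_edges U F v. a e * rig_row q e x i) = p x i * ?P + s x * (t x * p x i)"
        using cone_equilibrium[OF F U(2) x, of a i] True low[OF x i] by (simp add: aS)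
      also have "\<dots> = p x i * (?P + s x * t x)" by (simp only: distrib_left mult_ac)
      finally show ?thesis using s by simp
    qed
  next
    case False
    then have "{w. {x, w} \<in> F} = {}" using U(1) by blast
    then show ?thesis using cone_equilibrium[OF F U(2) x, of a i] False by simp
  qed
  have "(\<Sum>e\<in>cone_edges U F v. a e * rig_row q e v i) = 0" if "i < d + 1" for i
    using sum_rig_row_vertices[OF simple_graph_cone[OF F apex U(2)], of a q i] eq that finite_V apex by simp
  moreover have "a e = 0" if "e \<notin> cone_edges U F v" for e
    using that by (auto simp: a_def cone_edges_def)
  ultimately have "a \<in> stresses (d + 1) (insert v V) q (cone_edges U F v)"
    using eq unfolding stresses_def by blast
  moreover have "scale F a e = b e" for e
  proof (cases "e \<in> F")
    case True
    then have "e \<subseteq> V" "finite e" using F unfolding simple_graph_def by auto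
    then have "(\<Prod>u\<in>e. t u) \<noteq> 0" using t_nonzero by auto
    then show ?thesis using True by (simp add: scale_def aF c_def)
  next
    case False
    then show ?thesis using b by (simp add: scale_def stresses_def)
  qed
  ultimately show ?thesis by blast
qed

lemma rows_indep_of_cone:
  assumes F: "simple_graph V F" and U: "\<Union>F \<subseteq> U" "U \<subseteq> V"
    and indep: "rows_indep (d + 1) (insert v V) q (cone_edges U F v)"
  shows "rows_indep d V p F"
  unfolding rows_indep_iff_stresses
proof (intro ballI allI)
  fix b e assume "b \<in> stresses d V p F"
  then obtain a where "a \<in> stresses (d + 1) (insert v V) q (cone_edges U F v)" "scale F a = b"
    using lift_stress[OF F U] by blast
  then show "b e = 0" using indep unfolding rows_indep_iff_stresses by (auto simp: scale_def)
qed

end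

section \<open>Independence and circuits of cones\<close>

lemma cone_config_lift:
  assumes "finite V" "v \<notin> V" "\<And>u. u \<in> V \<Longrightarrow> t u \<noteq> 0"
  shows "cone_config V v d (\<lambda>u i. if u = v then 0 else if i < d then t u * p u i else t u) p t"
  using assms by unfold_locales auto

text \<open>Every configuration whose vertices avoid the height of the apex arises by lifting its
  perspective image.\<close>

lemma cone_config_project:
  assumes "finite V" "v \<notin> V" "\<And>u. u \<in> V \<Longrightarrow> q u d \<noteq> q v d"
  shows "cone_config V v d q (\<lambda>u i. (q u i - q v i) / (q u d - q v d)) (\<lambda>u. q u d - q v d)"
  using assms by unfold_locales auto

text \<open>Lifting to constant height 1 carries independence up, and projecting a generic
  configuration carries it down; \<open>rig_indep_iff_exists\<close> accepts the special positions
  that arise.\<close>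

lemma rig_indep_cone_iff:
  assumes V: "v \<notin> V" and F: "simple_graph V F" and U: "\<Union>F \<subseteq> U" "U \<subseteq> V"
  shows "rig_indep (d + 1) (insert v V) (cone_edges U F v) \<longleftrightarrow> rig_indep d V F"
proof
  have fin: "finite V" using F by (simp add: simple_graph_def)
  note cone = simple_graph_cone[OF F V U(2)]
  {
    assume "rig_indep d V F"
    then obtain p where p: "rows_indep d V p F" using rig_indep_iff_exists[OF F] by blast
    interpret cone_config V v d "\<lambda>u i. if u = v then 0 else if i < d then 1 * p u i else 1" p "\<lambda>_. 1"
      using cone_config_lift[OF fin V, of "\<lambda>_. 1"] by simp
    show "rig_indep (d + 1) (insert v V) (cone_edges U F v)"
      using rows_indep_cone[OF F U(2) p] rig_indep_iff_exists[OF cone] by blast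
  next
    assume "rig_indep (d + 1) (insert v V) (cone_edges U F v)"
    then obtain q where q: "generic_config (d + 1) (insert v V) q"
      "rows_indep (d + 1) (insert v V) q (cone_edges U F v)"
      unfolding rig_indep_def by blast
    have "q u d \<noteq> q v d" if "u \<in> V" for u
      using generic_config_distinct[OF _ q(1), of u v d] that V fin by auto
    then interpret cone_config V v d q "\<lambda>u i. (q u i - q v i) / (q u d - q v d)" "\<lambda>u. q u d - q v d"
      by (rule cone_config_project[OF fin V])
    show "rig_indep d V F"
      using rows_indep_of_cone[OF F U q(2)] rig_indep_iff_exists[OF F] by blast
  }
qed

lemma rig_indep_subset:
  assumes "simple_graph V F" "rig_indep k V F" "D \<subseteq> F"
  shows "rig_indep k V D"
proof -
  obtain p where p: "generic_config k V p"
    using generic_config_exists[of V k] assms(1) unfolding simple_graph_def by blast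
  show ?thesis
    using assms(2,3) stress_space.indep_mono[OF stress_space_stresses[OF assms(1)]]
      rig_indep_iff_stress_indep[OF assms(1) p] by blast
qed

text \<open>Deleting a spoke at x breaks the dependence: scaling a single neighbour of x in the lifted
  configuration makes the forced coefficient of that spoke a nonzero multiple of the coefficient
  of one edge of C.\<close>
lemma rig_indep_cone_minus_spoke:
  assumes V: "v \<notin> V" and E: "simple_graph V E" and C: "rig_circuit d V E C"
    and x: "x \<in> \<Union>C"
  shows "rig_indep (d + 1) (insert v V) (cone_edges (\<Union>C) C v - {{x, v}})"
proof -
  have fin: "finite V" using E by (simp add: simple_graph_def)
  have CE: "C \<subseteq> E" using C by (simp add: rig_circuit_def)
  note gC = simple_graph_subset[OF E CE]
  have U: "\<Union>C \<subseteq> V" using gC unfolding simple_graph_def by fastforce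
  note cone = simple_graph_cone[OF gC V U]
  obtain e where "e \<in> C" "x \<in> e" using x by blast
  then obtain y where y: "{x, y} \<in> C" "x \<in> V" "y \<in> V" "x \<noteq> y"
    using simple_graph_edge_at[OF gC] by metis
  \<comment> \<open>The missing spoke will force the coefficient of \<open>{x, y}\<close> to vanish,
    so the scaled stress lives on this independent set.\<close>
  have "rig_indep d V (C - {{x, y}})" using C y(1) unfolding rig_circuit_def by blast
  then obtain p where p: "rows_indep d V p (C - {{x, y}})" unfolding rig_indep_def by blast
  define t where "t = (\<lambda>u. if u = y then 2 else 1 :: real)"
  let ?q = "\<lambda>u i. if u = v then 0 else if i < d then t u * p u i else t u"
  interpret cone_config V v d ?q p t
    by (rule cone_config_lift[OF fin V]) (simp add: t_def)
  let ?H = "cone_edges (\<Union>C) C v"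
  have "rows_indep (d + 1) (insert v V) ?q (?H - {{x, v}})"
    unfolding rows_indep_iff_stresses
  proof (intro ballI allI)
    fix a e assume "a \<in> stresses (d + 1) (insert v V) ?q (?H - {{x, v}})"
    then have a: "a \<in> stresses (d + 1) (insert v V) ?q ?H" "a {x, v} = 0"
      using stresses_subgraph[OF simple_graph_finite_edges[OF cone], of "?H - {{x, v}}" a] by auto
    have N: "{w. {x, w} \<in> C} \<subseteq> V" using simple_graph_edgeD[OF gC] by blast
    have "(\<Sum>w | {x, w} \<in> C. a {x, w} * (t x - t w)) = (\<Sum>w\<in>{y}. a {x, w} * (t x - t w))"
      using y finite_subset[OF N fin] by (intro sum.mono_neutral_right) (auto simp: t_def)
    then have "a {x, y} = 0"
      using spoke_stress[OF gC U y(2) a(1)] a(2) y x by (simp add: t_def split: if_splits)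
    then have z: "scale C a e = 0" if "e \<notin> C - {{x, y}}" for e
      using that by (auto simp: scale_def)
    have "scale C a \<in> stresses d V p (C - {{x, y}})"
      using stresses_subgraph[OF simple_graph_finite_edges[OF gC], of "C - {{x, y}}" "scale C a"]
        scale_stress[OF gC U a(1)] z by blast
    then have "scale C a e = 0" for e using p unfolding rows_indep_iff_stresses by blast
    then show "a e = 0" by (rule cone_stress_zero[OF gC U a(1)])
  qed
  then show ?thesis
    using rig_indep_iff_exists[OF simple_graph_subset[OF cone Diff_subset]] by blast
qed

text \<open>A proper subset misses an edge of \<open>C\<close>, and then lies in the cone over an
  independent set, or misses a spoke, which is the case of
  \<open>rig_indep_cone_minus_spoke\<close>.\<close>

lemma rig_circuit_cone:
  assumes V: "v \<notin> V" and E: "simple_graph V E" and C: "rig_circuit d V E C"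
  shows "rig_circuit (d + 1) (insert v V) (cone_edges V E v) (cone_edges (\<Union>C) C v)"
proof -
  let ?H = "cone_edges (\<Union>C) C v"
  have CE: "C \<subseteq> E" using C by (simp add: rig_circuit_def)
  note gC = simple_graph_subset[OF E CE]
  have U: "\<Union>C \<subseteq> V" using gC unfolding simple_graph_def by fastforce
  note cone = simple_graph_cone[OF gC V U]
  have "?H \<subseteq> cone_edges V E v" using CE U unfolding cone_edges_def by blast
  moreover have "\<not> rig_indep (d + 1) (insert v V) ?H"
    using rig_indep_cone_iff[OF V gC subset_refl U, of d] C unfolding rig_circuit_def by blast
  moreover have "rig_indep (d + 1) (insert v V) D" if D: "D \<subset> ?H" for D
  proof -
    obtain e where e: "e \<in> ?H" "e \<notin> D" using D by blast
    have "\<exists>D'. D \<subseteq> D' \<and> simple_graph (insert v V) D' \<and> rig_indep (d + 1) (insert v V) D'"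
    proof (cases "e \<in> C")
      case True
      let ?D = "cone_edges (\<Union>C) (C - {e}) v"
      have g: "simple_graph V (C - {e})" by (rule simple_graph_subset[OF gC]) blast
      have "rig_indep d V (C - {e})" using C True unfolding rig_circuit_def by blast
      then have "rig_indep (d + 1) (insert v V) ?D"
        using rig_indep_cone_iff[OF V g _ U, of d] by blast
      moreover have "D \<subseteq> ?D" using D e unfolding cone_edges_def by blast
      ultimately show ?thesis using simple_graph_cone[OF g V U] by blast
    next
      case False
      then obtain x where "x \<in> \<Union>C" "e = {x, v}" using e(1) unfolding cone_edges_def by blast
      then have "rig_indep (d + 1) (insert v V) (?H - {e})"
        using rig_indep_cone_minus_spoke[OF V E C] by simp
      moreover have "D \<subseteq> ?H - {e}" using D e by blast
      ultimately show ?thesis using simple_graph_subset[OF cone Diff_subset] by blast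
    qed
    then show ?thesis using rig_indep_subset by blast
  qed
  ultimately show ?thesis unfolding rig_circuit_def by blast
qed

text \<open>A circuit of a graph glued at the single vertex v lies on one side: the stress restricted to
  the edges meeting A is in equilibrium away from v, and then also at v because the rows sum to 0
  over the vertices.\<close>
lemma M_connected_cone_imp_connected:
  assumes V: "v \<notin> V" and E: "simple_graph V E"
    and conn: "M_connected k (insert v V) (cone_edges V E v)"
  shows "graph_connected V E"
proof (rule ccontr)
  let ?R = "{(a, b). {a, b} \<in> E}" and ?K = "cone_edges V E v" and ?V = "insert v V"
  note K = simple_graph_cone[OF E V subset_refl]
  assume "\<not> graph_connected V E"
  then obtain u w where uw: "u \<in> V" "w \<in> V" "(u, w) \<notin> ?R\<^sup>*" unfolding graph_connected_def by blast
  then have ne: "{u, v} \<noteq> {w, v}" by (auto simp: doubleton_eq_iff)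
  \<comment> \<open>\<open>A\<close> is the vertex set of the component of \<open>u\<close> in the
    graph without the apex.\<close>
  define A where "A = {x\<in>V. (u, x) \<in> ?R\<^sup>*}"
  have A: "y \<in> A" if "x \<in> A" "{x, y} \<in> E" for x y
    using that simple_graph_edgeD[OF E] unfolding A_def by (auto intro: rtrancl_into_rtrancl)
  have "{u, v} \<in> ?K" "{w, v} \<in> ?K" using uw unfolding cone_edges_def by blast+
  then obtain C where C: "rig_circuit k ?V ?K C" "{u, v} \<in> C" "{w, v} \<in> C"
    using conn[unfolded M_connected_def, rule_format, OF _ _ ne] by blast
  have "finite ?V" using E by (simp add: simple_graph_def)
  then obtain q where q: "generic_config k ?V q" using generic_config_exists by blast
  interpret stress_space ?K "stresses k ?V q ?K" by (rule stress_space_stresses[OF K])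
  have circ: "circuit C" using C(1) rig_circuit_iff_stress_circuit[OF K q] by simp
  then obtain a where a: "a \<in> stresses k ?V q ?K" "{e. a e \<noteq> 0} = C" by (rule circuit_stress)
  define a' where "a' = (\<lambda>e. if e \<inter> A \<noteq> {} then a e else 0)"
  have eq: "(\<Sum>e\<in>?K. a' e * rig_row q e x i) = 0" if x: "x \<in> V" and i: "i < k" for x i
  proof (cases "x \<in> A")
    case True
    then have "(\<Sum>e\<in>?K. a' e * rig_row q e x i) = (\<Sum>e\<in>?K. a e * rig_row q e x i)"
      by (intro sum.cong) (auto simp: a'_def rig_row_def)
    then show ?thesis using a(1) x i unfolding stresses_def by simp
  next
    case False
    have "a' e * rig_row q e x i = 0" if e: "e \<in> ?K" for e
    proof (cases "x \<in> e")
      case xe: True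
      have "e \<inter> A = {}"
      proof (cases "e \<in> E")
        case True
        then obtain y where y: "e = {x, y}" using simple_graph_edge_at[OF E _ xe] by blast
        then have "y \<notin> A" using A[of y x] True False by (auto simp: insert_commute)
        then show ?thesis using y False by simp
      next
        case nE: False
        then obtain y where "e = {y, v}" using e unfolding cone_edges_def by blast
        then have "e = {x, v}" using xe x V by auto
        then show ?thesis using False V by (auto simp: A_def)
      qed
      then show ?thesis by (simp add: a'_def)
    qed (simp add: rig_row_notin)
    then show ?thesis by (rule sum.neutral[OF ballI])
  qed
  have "(\<Sum>e\<in>?K. a' e * rig_row q e v i) = 0" if "i < k" for i
    using sum_rig_row_vertices[OF K, of a' q i] eq that V \<open>finite ?V\<close> by simp
  moreover have "a' e = 0" if "e \<notin> ?K" for e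
    using zero_outside[OF a(1) that] by (simp add: a'_def)
  ultimately have a': "a' \<in> stresses k ?V q ?K" using eq unfolding stresses_def by blast
  \<comment> \<open>The restricted stress loses \<open>{w, v}\<close>, so it is supported on a
    proper subset of the circuit and must vanish, although it agrees with \<open>a\<close> at
    \<open>{u, v}\<close>.\<close>
  have "{w, v} \<inter> A = {}" using uw V unfolding A_def by auto
  then have "a' e = 0" if "e \<notin> C - {{w, v}}" for e
    using that a(2) unfolding a'_def by auto
  moreover have "indep (C - {{w, v}})" using circ C(3) unfolding circuit_def by blast
  ultimately have "a' {u, v} = 0" using a' unfolding indep_def by blast
  moreover have "u \<in> A" using uw by (simp add: A_def)
  ultimately show False using a(2) C(2) unfolding a'_def by auto
qed

text \<open>The cone over a maximal independent \<open>I\<close> in \<open>E - {e}\<close> spans all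
  cone edges other than \<open>e\<close>. A cone stress through \<open>e\<close> puts
  \<open>e\<close> in the span too, and this dependence descends to \<open>insert e I\<close>,
  giving a stress of the graph that is nonzero at \<open>e\<close>.\<close>

lemma M_connected_cone_imp_no_bridge:
  assumes V: "v \<notin> V" and E: "simple_graph V E" and d: "1 \<le> d"
    and conn: "M_connected (d + 1) (insert v V) (cone_edges V E v)" and e: "e \<in> E"
  shows "\<not> M_bridge d V E e"
proof -
  let ?K = "cone_edges V E v" and ?V = "insert v V"
  note K = simple_graph_cone[OF E V subset_refl]
  have fin: "finite V" using E by (simp add: simple_graph_def)
  obtain p where p: "generic_config d V p" using generic_config_exists[OF fin] by blast
  obtain q where q: "generic_config (d + 1) ?V q" using generic_config_exists[of ?V] fin by blast
  interpret W: stress_space E "stresses d V p E" by (rule stress_space_stresses[OF E])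
  interpret W': stress_space ?K "stresses (d + 1) ?V q ?K" by (rule stress_space_stresses[OF K])
  have cone: "W'.indep (cone_edges V F v) \<longleftrightarrow> W.indep F" if F: "F \<subseteq> E" for F
  proof -
    have g: "simple_graph V F" by (rule simple_graph_subset[OF E F])
    have "\<Union>F \<subseteq> V" using g unfolding simple_graph_def by fastforce
    moreover have "cone_edges V F v \<subseteq> ?K" using F unfolding cone_edges_def by blast
    ultimately show ?thesis
      using rig_indep_cone_iff[OF V g _ subset_refl] rig_indep_iff_stress_indep[OF E p F]
        rig_indep_iff_stress_indep[OF K q] by blast
  qed
  obtain u w where uw: "e = {u, w}" "u \<noteq> w" "u \<in> V" "w \<in> V" using E e by (rule simple_graph_edgeE)
  have "{u, v} \<in> ?K" "e \<in> ?K" using uw e unfolding cone_edges_def by blast+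
  \<comment> \<open>The spoke serves as a second edge, since \<open>M_connected\<close> speaks of
    distinct pairs.\<close>
  moreover have "{u, v} \<noteq> e" using uw V by (auto simp: doubleton_eq_iff)
  ultimately obtain C where "rig_circuit (d + 1) ?V ?K C" "e \<in> C"
    using conn[unfolded M_connected_def, rule_format, of "{u, v}" e] by blast
  then have "W'.circuit C" "e \<in> C" using rig_circuit_iff_stress_circuit[OF K q] by simp_all
  then obtain a where a: "a \<in> stresses (d + 1) ?V q ?K" "a e \<noteq> 0"
    using W'.circuit_stress by blast
  let ?P = "\<lambda>I. I \<subseteq> E - {e} \<and> W.indep I"
  have "card I \<le> card E" if "?P I" for I
    using that simple_graph_finite_edges[OF E] by (intro card_mono) auto
  then obtain I where I: "?P I" "\<And>I'. ?P I' \<Longrightarrow> card I' \<le> card I"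
    using Lattices_Big.ex_has_greatest_nat[of ?P "{}" card "Suc (card E)"] W.indep_empty by (auto simp: le_imp_less_Suc)
  let ?J = "cone_edges V I v"
  have ins: "insert f ?J = cone_edges V (insert f I) v" for f unfolding cone_edges_def by blast
  have IE: "I \<subseteq> E" using I(1) by blast
  have "W'.indep ?J" using cone[OF IE] I(1) by blast
  moreover have "e \<notin> ?J" using I(1) spoke_notin[OF E V] e unfolding cone_edges_def by blast
  moreover have "\<not> W'.indep (insert f ?J)" if f: "f \<in> ?K - ?J - {e}" for f
  proof -
    \<comment> \<open>All spokes already belong to \<open>?J\<close>, so \<open>f\<close> is an edge
      of the original graph and maximality of \<open>I\<close> applies.\<close>
    have f': "f \<in> E" "f \<notin> I" "f \<noteq> e" using f unfolding cone_edges_def by blast+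
    have "finite I" using IE simple_graph_finite_edges[OF E] finite_subset by blast
    then have "\<not> ?P (insert f I)" using I(2)[of "insert f I"] f'(2) by auto
    then have "\<not> W.indep (insert f I)" using f' I(1) by blast
    then show ?thesis using cone[of "insert f I"] f'(1) IE ins by simp
  qed
  ultimately have "\<not> W'.indep (insert e ?J)"
    using W'.dependent_insert_of_stress[OF _ _ a] by blast
  then have "\<not> W.indep (insert e I)" using cone[of "insert e I"] e IE ins by simp
  then obtain b where b: "b \<in> stresses d V p E" "\<forall>g. g \<notin> insert e I \<longrightarrow> b g = 0" "\<exists>g. b g \<noteq> 0"
    unfolding W.indep_def by blast
  have "b e \<noteq> 0"
  proof
    assume "b e = 0"
    then have "\<forall>g. g \<notin> I \<longrightarrow> b g = 0" using b(2) by (metis insert_iff)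
    then show False using I(1) b(1,3) unfolding W.indep_def by blast
  qed
  then show ?thesis using M_bridge_iff_unstressed[OF E p d e] b(1) by blast
qed

lemma M_connected_cone_if:
  assumes V: "v \<notin> V" and E: "simple_graph V E" and d: "1 \<le> d"
    and conn: "graph_connected V E" and nb: "\<forall>e\<in>E. \<not> M_bridge d V E e"
  shows "M_connected (d + 1) (insert v V) (cone_edges V E v)"
proof -
  let ?K = "cone_edges V E v" and ?V = "insert v V" and ?R = "{(a, b). {a, b} \<in> E}"
  note K = simple_graph_cone[OF E V subset_refl]
  have fin: "finite V" using E by (simp add: simple_graph_def)
  obtain p where p: "generic_config d V p" using generic_config_exists[OF fin] by blast
  obtain q where q: "generic_config (d + 1) ?V q" using generic_config_exists[of ?V] fin by blast
  interpret W: stress_space E "stresses d V p E" by (rule stress_space_stresses[OF E])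
  interpret W': stress_space ?K "stresses (d + 1) ?V q ?K" by (rule stress_space_stresses[OF K])
  \<comment> \<open>The disjunct \<open>e = f\<close> makes \<open>S\<close> reflexive, hence an
    equivalence relation; it remains to see that it has one class.\<close>
  define S where "S = (\<lambda>e f. e = f \<or> (\<exists>C. W'.circuit C \<and> e \<in> C \<and> f \<in> C))"
  have S_sym: "S e f \<Longrightarrow> S f e" for e f unfolding S_def by blast
  have S_trans: "S e g" if "S e f" "S f g" for e f g
  proof (cases "e = f \<or> f = g")
    case False
    with that obtain C D where "W'.circuit C" "e \<in> C" "f \<in> C" "W'.circuit D" "f \<in> D" "g \<in> D"
      unfolding S_def by blast
    then show ?thesis using W'.common_circuit_of_meeting[of C D e g] unfolding S_def by blast
  qed (use that in auto)
  \<comment> \<open>The cone over a circuit through \<open>{x, y}\<close> contains this edge and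
    both spokes at its ends.\<close>
  have edge: "S {x, y} {x, v} \<and> S {x, v} {y, v}" if xy: "{x, y} \<in> E" for x y
  proof -
    obtain a where "a \<in> stresses d V p E" "a {x, y} \<noteq> 0"
      using nb xy M_bridge_iff_unstressed[OF E p d xy] by blast
    then obtain C where "W.circuit C" "{x, y} \<in> C" by (rule W.stress_in_circuit)
    then have "rig_circuit d V E C" using rig_circuit_iff_stress_circuit[OF E p] by simp
    then have "W'.circuit (cone_edges (\<Union>C) C v)"
      using rig_circuit_cone[OF V E] rig_circuit_iff_stress_circuit[OF K q] by blast
    moreover have "{x, y} \<in> cone_edges (\<Union>C) C v" "{x, v} \<in> cone_edges (\<Union>C) C v"
      "{y, v} \<in> cone_edges (\<Union>C) C v"
      using \<open>{x, y} \<in> C\<close> unfolding cone_edges_def by blast+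
    ultimately show ?thesis unfolding S_def by blast
  qed
  have spokes: "S {x, v} {y, v}" if "x \<in> V" "y \<in> V" for x y
  proof -
    have "(x, y) \<in> ?R\<^sup>*" using conn that unfolding graph_connected_def by blast
    then show ?thesis
    proof induction
      case base
      then show ?case by (simp add: S_def)
    next
      case (step y z)
      then show ?case using edge S_trans by blast
    qed
  qed
  have to_spoke: "\<exists>x\<in>V. S e {x, v}" if e: "e \<in> ?K" for e
  proof (cases "e \<in> E")
    case True
    with E obtain x y where "e = {x, y}" "x \<noteq> y" "x \<in> V" "y \<in> V" by (rule simple_graph_edgeE)
    then show ?thesis using edge True by blast
  next
    case False
    then show ?thesis using e unfolding cone_edges_def S_def by blast
  qed
  have "S e f" if "e \<in> ?K" "f \<in> ?K" for e f
    using to_spoke[OF that(1)] to_spoke[OF that(2)] spokes S_sym S_trans by meson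
  then show ?thesis
    using rig_circuit_iff_stress_circuit[OF K q] unfolding M_connected_def S_def by blast
qed

theorem theorem5p3:
  fixes d :: nat and V :: "'a set" and E :: "'a set set" and v :: 'a
  assumes "d \<ge> 1"
    and "simple_graph V E"
    and "V \<noteq> {}"
    and "v \<notin> V"
  shows "M_connected (d + 1) (cone_vertices V v) (cone_edges V E v)
         \<longleftrightarrow> graph_connected V E \<and> (\<forall>e\<in>E. \<not> M_bridge d V E e)"
  unfolding cone_vertices_def
  using M_connected_cone_imp_connected[OF assms(4,2)]
    M_connected_cone_imp_no_bridge[OF assms(4,2,1)] M_connected_cone_if[OF assms(4,2,1)]
  by blast

end
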